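(* Let $P>0$ be fixed and let $\overline{\mathcal T}_1=\overline{\mathcal T}_1(K)$ be the throughput, with $K$ users, of Strategy I (SNR-based scheduling with a fixed codeword length), as defined in the context. Then, as $K\to\infty$, $$\overline{\mathcal T}_1 = \log\left(\frac{P\log K}{2}\right)-2\,(1+o(1))\sqrt{\mathbb{E}\{\log(\alpha^{-1})\}\,\log\log\log K},$$ where $\alpha$ is uniformly distributed on $(0,1)$.
   Context: **Channel.** There are $K$ users. User $k$ has a correlation coefficient $\alpha_k$ and an initial fading gain $u_{0,k}$; the $\alpha_k$ are i.i.d. uniform on $(0,1)$, the $u_{0,k}$ are i.i.d. with Rayleigh density $2ue^{-u^2}$, $u\ge0$, and the two families are independent. For a user with parameters $(u_0,\alpha)$, conditioned on these, the gains $u_1,u_2,\dots$ form a Markov chain started at $u_0$ with transition density, for $u\ge 0$, $$q(u\mid v)=\frac{2u}{1-\alpha^2}\exp\left(-\frac{u^2+\alpha^2v^2}{1-\alpha^2}\right)\mathcal{I}_0\left(\frac{2\alpha uv}{1-\alpha^2}\right),$$ with $\mathcal I_0$ the modified Bessel function of order zero. **Throughput of one user.** For codeword length $N$ and $\rho\in[0,1]$ let $$E_N(\rho;u_0,\alpha)=-\frac1N\log\mathbb{E}\left\{\prod_{i=1}^N\left(\frac{1}{1+\frac{P}{1+\rho}u_i^2}\right)^{\rho}\ \Big|\ u_0,\alpha\right\}$$ (random coding error exponent). For rate $R\ge0$ (nats per channel use) the throughput, with the frame error probability evaluated by its random coding upper bound, is $$T(u_0,\alpha;N,R)=R\left(1-\inf_{0\le\rho\le1}e^{-N(E_N(\rho;u_0,\alpha)-\rho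 R)}\right).$$ **Strategy I.** The base station transmits to the user $k^*=\arg\max_{1\le k\le K}u_{0,k}$. The codeword length $N$ is the same for all users and is chosen (depending on $K$ only) to maximize the system throughput; the rate is adapted to the selected user's parameters to maximize its throughput. Thus $$\overline{\mathcal T}_1(K)=\sup_{N}\ \mathbb{E}\left\{\sup_{R\ge0}T(u_{0,k^*},\alpha_{k^*};N,R)\right\}.$$ $\log$ is the natural logarithm. *)

theory Defs
  imports "HOL-Probability.Probability"
begin

section \<open>Channel\<close>

text \<open>Modified Bessel function of the first kind of order zero, by its power series.\<close>

definition bessel_I0 :: "real \<Rightarrow> real" where
  "bessel_I0 x = (\<Sum>k. (x / 2) ^ (2 * k) / (fact k)\<^sup>2)"

definition rayleigh_density :: "real \<Rightarrow> real" where
  "rayleigh_density u = (if u < 0 then 0 else 2 * u * exp (- u\<^sup>2))"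

text \<open>\<open>trans_density \<alpha> v u\<close> is $q(u\mid v)$: the first gain argument is the one conditioned on.\<close>

definition trans_density :: "real \<Rightarrow> real \<Rightarrow> real \<Rightarrow> real" where
  "trans_density \<alpha> v u =
     (if u < 0 then 0
      else 2 * u / (1 - \<alpha>\<^sup>2) * exp (- ((u\<^sup>2 + \<alpha>\<^sup>2 * v\<^sup>2) / (1 - \<alpha>\<^sup>2)))
             * bessel_I0 (2 * \<alpha> * u * v / (1 - \<alpha>\<^sup>2)))"

text \<open>
  Conditional law of $(u_1,\dots,u_N)$ given $(u_0,\alpha)$: the joint law of the first \<open>N\<close>
  steps of the Markov chain started at \<open>u0\<close>. The update \<open>u(0 := u0)\<close> supplies the
  predecessor of the first step.
\<close>

definition gain_law :: "real \<Rightarrow> real \<Rightarrow> nat \<Rightarrow> (nat \<Rightarrow> real) measure" where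
  "gain_law u0 \<alpha> N =
     density (Pi\<^sub>M {1..N} (\<lambda>_. lborel))
       (\<lambda>u. ennreal (\<Prod>i\<in>{1..N}. trans_density \<alpha> ((u(0 := u0)) (i - 1)) (u i)))"

section \<open>Throughput of one user\<close>

definition error_exponent :: "real \<Rightarrow> nat \<Rightarrow> real \<Rightarrow> real \<Rightarrow> real \<Rightarrow> real" where
  "error_exponent P N \<rho> u0 \<alpha> =
     - (1 / real N) * ln (\<integral>u. (\<Prod>i\<in>{1..N}. (1 / (1 + P / (1 + \<rho>) * (u i)\<^sup>2)) powr \<rho>)
                            \<partial>gain_law u0 \<alpha> N)"

definition user_throughput :: "real \<Rightarrow> real \<Rightarrow> real \<Rightarrow> nat \<Rightarrow> real \<Rightarrow> real" where
  "user_throughput P u0 \<alpha> N R =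
     R * (1 - (INF \<rho>\<in>{0..1}. exp (- (real N * (error_exponent P N \<rho> u0 \<alpha> - \<rho> * R)))))"

section \<open>Scheduling\<close>

definition uniform_law :: "real measure" where
  "uniform_law = uniform_measure lborel {0<..<1}"

text \<open>
  Joint law of the parameters $(u_{0,k},\alpha_k)$, $1\le k\le K$; all \<open>2 * K\<close> coordinates are
  independent.
\<close>

definition users_law :: "nat \<Rightarrow> (nat \<Rightarrow> real \<times> real) measure" where
  "users_law K =
     Pi\<^sub>M {1..K} (\<lambda>_. density lborel (\<lambda>u. ennreal (rayleigh_density u)) \<Otimes>\<^sub>M uniform_law)"

text \<open>Ties, which have probability zero, are broken arbitrarily by \<open>ARG_MAX\<close>.\<close>

definition best_user :: "nat \<Rightarrow> (nat \<Rightarrow> real \<times> real) \<Rightarrow> nat" where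
  "best_user K \<omega> = (ARG_MAX (\<lambda>k. fst (\<omega> k)) k. k \<in> {1..K})"

text \<open>
  The suprema and the expectation are taken in the extended nonnegative reals, so that no
  boundedness or integrability is presupposed. The coercion \<open>ennreal\<close> does not alter the
  supremum over the rate, since the throughput at \<open>R = 0\<close> is \<open>0\<close>.
\<close>

definition strategy1_throughput :: "real \<Rightarrow> nat \<Rightarrow> ennreal" where
  "strategy1_throughput P K =
     (SUP N\<in>{1..}. \<integral>\<^sup>+\<omega>.
        (SUP R\<in>{0..}. ennreal (user_throughput P (fst (\<omega> (best_user K \<omega>)))
                                 (snd (\<omega> (best_user K \<omega>))) N R))
        \<partial>users_law K)"

end

theory Submission
  imports Defs "HOL-Real_Asymp.Real_Asymp"
begin

text \<open>
  Write $L = \log K$, $M = \log\log\log K$ and $\lambda = \log(1/\alpha)$; under the uniform law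
  $\lambda$ has mean $1$. The selected user has $u_0^2 \approx L$ and an unbiased $\alpha$, and
  $u_i^2 \approx \alpha^{2i} u_0^2$, so that the mean log-gain over a codeword of length $N$ is about
  $\log L - (N+1)\lambda$. The rate has to stay about $M/N$ below that: a smaller margin $\delta$ costs
  $\log L \cdot e^{-N\delta}$. The total loss $N + M/N$ is at least $2\sqrt M$, with equality at
  $N \approx \sqrt M$.

  For the upper bound, Jensen's inequality bounds the error probability from below. For the lower
  bound only $\rho = 1$ is used, and a Chernoff bound, based on the Laplace transform of the Rice
  distribution, shows that no step loses much more than the factor $\alpha^2$. Factors such as the
  $1/2$ in $P\log K/2$ contribute only $O(1)$.
\<close>

section \<open>The transition density\<close>

text \<open>Errors of smaller order than sqrt M are allowed and M tends to infinity, so bounded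
  errors are free; but the upper bound has to hold for every N at once. The obstacle is small
  \<alpha>: \<lambda> is unbounded, whereas the terms ln (1 + P u^2) never become negative, so that
  the loss of a codeword is linear in \<lambda> only up to a cut-off \<open>B\<close>. Both
  directions pay for the cut-off with a quadratic term, whose mean is known because \<lambda> has
  second moment 2. The upper bound uses min \<lambda> B >= \<lambda> - \<lambda>^2 / (4 B). The
  lower bound uses a minorant containing - D \<lambda>^2 / B^2, which is nonpositive as soon as
  \<lambda> >= B, so that large \<lambda> need no estimate. The slacks \<theta> < 1 (upper bound)
  and t > 0 (lower bound) stay fixed while K tends to infinity and are removed only at the very
  end.\<close>

lemma nn_integral_odd_moment:
  fixes r :: real
  assumes "r > 0"
  shows "(\<integral>\<^sup>+u. ennreal (2 * u ^ (2 * k + 1) * exp (- r * u\<^sup>2)) * indicator {0..} u \<partial>lborel)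
    = ennreal (fact k / r ^ (k + 1))"
proof -
  let ?c = "inverse (sqrt r)"
  have c: "?c \<noteq> 0" "?c > 0" using assms by auto
  \<comment> \<open>Rescaling by 1 / sqrt r turns the weight into exp (- x^2), whose odd moments are
    k! / 2.\<close>
  have "(\<integral>\<^sup>+u. ennreal (2 * u ^ (2 * k + 1) * exp (- r * u\<^sup>2)) * indicator {0..} u \<partial>lborel)
      = ennreal \<bar>?c\<bar> * (\<integral>\<^sup>+x. ennreal (2 * (0 + ?c * x) ^ (2 * k + 1) * exp (- r * (0 + ?c * x)\<^sup>2)) * indicator {0..} (0 + ?c * x) \<partial>lborel)"
    by (rule nn_integral_real_affine) (use c in auto)
  also have "(\<integral>\<^sup>+x. ennreal (2 * (0 + ?c * x) ^ (2 * k + 1) * exp (- r * (0 + ?c * x)\<^sup>2)) * indicator {0..} (0 + ?c * x) \<partial>lborel)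
     = (\<integral>\<^sup>+x. ennreal (2 * ?c ^ (2 * k + 1)) * ennreal (indicator {0..} x *\<^sub>R (exp (- x\<^sup>2) * x ^ (2 * k + 1))) \<partial>lborel)"
  proof (rule nn_integral_cong)
    fix x :: real
    show "ennreal (2 * (0 + ?c * x) ^ (2 * k + 1) * exp (- r * (0 + ?c * x)\<^sup>2)) * indicator {0..} (0 + ?c * x)
      = ennreal (2 * ?c ^ (2 * k + 1)) * ennreal (indicator {0..} x *\<^sub>R (exp (- x\<^sup>2) * x ^ (2 * k + 1)))"
    proof (cases "x \<ge> 0")
      case True
      have e: "- r * (0 + ?c * x)\<^sup>2 = - x\<^sup>2"
        using assms by (simp add: power_mult_distrib power_inverse)
      have "ennreal (2 * (0 + ?c * x) ^ (2 * k + 1) * exp (- r * (0 + ?c * x)\<^sup>2))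
         = ennreal ((2 * ?c ^ (2 * k + 1)) * (exp (- x\<^sup>2) * x ^ (2 * k + 1)))"
        unfolding e by (simp add: power_mult_distrib algebra_simps)
      also have "\<dots> = ennreal (2 * ?c ^ (2 * k + 1)) * ennreal (exp (- x\<^sup>2) * x ^ (2 * k + 1))"
        using c(2) True by (intro ennreal_mult) auto
      finally show ?thesis
        using True c(2) by (simp add: zero_le_mult_iff)
    next
      case False
      then have "\<not> 0 \<le> ?c * x" using c(2) by (simp add: zero_le_mult_iff)
      then show ?thesis using False by simp
    qed
  qed
  also have "\<dots> = ennreal (2 * ?c ^ (2 * k + 1)) * (\<integral>\<^sup>+x. ennreal (indicator {0..} x *\<^sub>R (exp (- x\<^sup>2) * x ^ (2 * k + 1))) \<partial>lborel)"
    by (rule nn_integral_cmult) measurable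
  also have "(\<integral>\<^sup>+x. ennreal (indicator {0..} x *\<^sub>R (exp (- x\<^sup>2) * x ^ (2 * k + 1))) \<partial>lborel) = ennreal (fact k / 2)"
    by (rule nn_integral_eq_integrable[THEN iffD2, OF _ _ _ gaussian_moment_odd_pos[THEN has_bochner_integral_iff[THEN iffD1]]])
      (auto intro!: AE_I2 simp: indicator_def)
  also have "ennreal \<bar>?c\<bar> * (ennreal (2 * ?c ^ (2 * k + 1)) * ennreal (fact k / 2)) = ennreal (fact k * (?c\<^sup>2) ^ (k + 1))"
    using c(2) by (simp add: ennreal_mult[symmetric] power_mult power2_eq_square algebra_simps)
  also have "fact k * (?c\<^sup>2) ^ (k + 1) = fact k / r ^ (k + 1)"
    using assms by (simp add: power_inverse divide_inverse)
  finally show ?thesis .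
qed

section \<open>The Rice transition density through its Bessel series\<close>

lemma summable_bessel_I0: "summable (\<lambda>k. (x / 2) ^ (2 * k) / (fact k)\<^sup>2 :: real)"
proof (rule summable_comparison_test'[where N = 0])
  show "summable (\<lambda>k. inverse (fact k) * ((x / 2)\<^sup>2) ^ k)" by (rule summable_exp)
  fix k :: nat
  have "(1::real) \<le> fact k" by simp
  then have "(fact k :: real) \<le> (fact k)\<^sup>2" by (simp add: power2_eq_square)
  then have "inverse ((fact k)\<^sup>2) \<le> (inverse (fact k) :: real)" by (intro le_imp_inverse_le) simp_all
  then have "inverse ((fact k)\<^sup>2) * ((x / 2)\<^sup>2) ^ k \<le> inverse (fact k) * ((x / 2)\<^sup>2) ^ k"
    by (intro mult_right_mono) auto
  moreover have "norm ((x / 2) ^ (2 * k) / (fact k)\<^sup>2) = inverse ((fact k)\<^sup>2) * ((x / 2)\<^sup>2) ^ k"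
    unfolding power_mult real_norm_def divide_inverse[of _ "(fact k)\<^sup>2"] by (simp add: abs_mult)
  ultimately show "norm ((x / 2) ^ (2 * k) / (fact k)\<^sup>2) \<le> inverse (fact k) * ((x / 2)\<^sup>2) ^ k" by simp
qed

lemma bessel_I0_nonneg: "0 \<le> bessel_I0 x"
  unfolding bessel_I0_def by (intro suminf_nonneg summable_bessel_I0) (auto simp: power_mult)

lemma measurable_bessel_I0 [measurable]: "bessel_I0 \<in> borel_measurable borel"
  unfolding bessel_I0_def by measurable

lemma measurable_trans_density [measurable]:
  assumes [measurable]: "f \<in> borel_measurable M" "g \<in> borel_measurable M"
  shows "(\<lambda>x. trans_density \<alpha> (f x) (g x)) \<in> borel_measurable M"
  unfolding trans_density_def by measurable

lemma trans_density_nonneg: "0 < \<alpha> \<Longrightarrow> \<alpha> < 1 \<Longrightarrow> 0 \<le> trans_density \<alpha> v u"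
  unfolding trans_density_def
  by (auto intro!: mult_nonneg_nonneg divide_nonneg_nonneg bessel_I0_nonneg simp: power_le_one)

text \<open>The Bessel series is integrated term by term, which nonnegativity permits; each term is
  an odd Gaussian moment with rate \<open>1 / \<sigma> + s\<close>. The weight is general because
  two instances are wanted: \<open>j = 0\<close> gives the Laplace transform of the squared gain,
  \<open>j = 1\<close> with \<open>s = 0\<close> its mean.\<close>

lemma nn_integral_trans_density_series:
  assumes \<alpha>: "0 < \<alpha>" "\<alpha> < 1" and s: "s \<ge> 0"
  defines "\<sigma> \<equiv> 1 - \<alpha>\<^sup>2"
  shows "(\<integral>\<^sup>+u. ennreal (trans_density \<alpha> v u * (u ^ (2 * j) * exp (- s * u\<^sup>2))) \<partial>lborel)
    = (\<Sum>k. ennreal (exp (- (\<alpha>\<^sup>2 * v\<^sup>2 / \<sigma>)) / \<sigma> * ((\<alpha> * v / \<sigma>)\<^sup>2) ^ k / (fact k)\<^sup>2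
        * (fact (k + j) / (1 / \<sigma> + s) ^ (k + j + 1))))"
proof -
  have \<sigma>: "\<sigma> > 0" unfolding \<sigma>_def using \<alpha> by (simp add: power_less_one_iff abs_square_less_1)
  define r where "r = 1 / \<sigma> + s"
  have r: "r > 0" unfolding r_def using \<sigma> s by (simp add: add_pos_nonneg)
  define C where "C k = exp (- (\<alpha>\<^sup>2 * v\<^sup>2 / \<sigma>)) / \<sigma> * ((\<alpha> * v / \<sigma>)\<^sup>2) ^ k / (fact k)\<^sup>2" for k :: nat
  have C: "C k \<ge> 0" for k unfolding C_def using \<sigma> by simp
  have pw: "ennreal (trans_density \<alpha> v u * (u ^ (2 * j) * exp (- s * u\<^sup>2)))
    = (\<Sum>k. ennreal (C k) * (ennreal (2 * u ^ (2 * (k + j) + 1) * exp (- r * u\<^sup>2)) * indicator {0..} u))" for u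
  proof (cases "u < 0")
    case True then show ?thesis by (simp add: trans_density_def)
  next
    case False
    let ?x = "2 * \<alpha> * u * v / \<sigma>"
    let ?E = "2 * u / \<sigma> * exp (- ((u\<^sup>2 + \<alpha>\<^sup>2 * v\<^sup>2) / \<sigma>)) * (u ^ (2 * j) * exp (- s * u\<^sup>2))"
    have "(\<lambda>k. ?E * ((?x / 2) ^ (2 * k) / (fact k)\<^sup>2)) sums (?E * bessel_I0 ?x)"
      unfolding bessel_I0_def by (intro sums_mult summable_sums summable_bessel_I0)
    also have "?E * bessel_I0 ?x = trans_density \<alpha> v u * (u ^ (2 * j) * exp (- s * u\<^sup>2))"
      using False by (simp add: trans_density_def \<sigma>_def)
    also have "(\<lambda>k. ?E * ((?x / 2) ^ (2 * k) / (fact k)\<^sup>2)) = (\<lambda>k. C k * (2 * u ^ (2 * (k + j) + 1) * exp (- r * u\<^sup>2)))"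
    proof
      fix k
      have e1: "exp (- ((u\<^sup>2 + \<alpha>\<^sup>2 * v\<^sup>2) / \<sigma>)) * exp (- s * u\<^sup>2) = exp (- (\<alpha>\<^sup>2 * v\<^sup>2 / \<sigma>)) * exp (- r * u\<^sup>2)"
        unfolding r_def exp_add[symmetric] by (simp add: add_divide_distrib ring_distribs)
      have e2: "(?x / 2) ^ (2 * k) = ((\<alpha> * v / \<sigma>)\<^sup>2) ^ k * u ^ (2 * k)"
        unfolding power_mult power_mult_distrib[symmetric] by (simp add: mult_ac)
      have e3: "u * u ^ (2 * j) * u ^ (2 * k) = u ^ (2 * (k + j) + 1)"
        by (simp add: power_add[symmetric] algebra_simps)
      have e4: "?E * ((?x / 2) ^ (2 * k) / (fact k)\<^sup>2) =
         2 / \<sigma> / (fact k)\<^sup>2 * (u * u ^ (2 * j)) * (exp (- ((u\<^sup>2 + \<alpha>\<^sup>2 * v\<^sup>2) / \<sigma>)) * exp (- s * u\<^sup>2)) * (?x / 2) ^ (2 * k)"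
        by (simp only: divide_inverse mult_ac)
      have "?E * ((?x / 2) ^ (2 * k) / (fact k)\<^sup>2) =
         2 / \<sigma> / (fact k)\<^sup>2 * (u * u ^ (2 * j)) * (exp (- (\<alpha>\<^sup>2 * v\<^sup>2 / \<sigma>)) * exp (- r * u\<^sup>2)) * (((\<alpha> * v / \<sigma>)\<^sup>2) ^ k * u ^ (2 * k))"
        by (subst e4, subst e1, subst e2) (rule refl)
      also have "\<dots> = 2 / \<sigma> / (fact k)\<^sup>2 * (u * u ^ (2 * j) * u ^ (2 * k)) * (exp (- (\<alpha>\<^sup>2 * v\<^sup>2 / \<sigma>)) * exp (- r * u\<^sup>2)) * ((\<alpha> * v / \<sigma>)\<^sup>2) ^ k"
        by (simp only: mult_ac)
      also have "\<dots> = C k * (2 * u ^ (2 * (k + j) + 1) * exp (- r * u\<^sup>2))"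
        unfolding C_def e3
        by (simp only: divide_inverse mult_ac)
      finally show "?E * ((?x / 2) ^ (2 * k) / (fact k)\<^sup>2) = C k * (2 * u ^ (2 * (k + j) + 1) * exp (- r * u\<^sup>2))" .
    qed
    finally have sm: "(\<lambda>k. C k * (2 * u ^ (2 * (k + j) + 1) * exp (- r * u\<^sup>2))) sums
        (trans_density \<alpha> v u * (u ^ (2 * j) * exp (- s * u\<^sup>2)))" .
    have nn: "0 \<le> C k * (2 * u ^ (2 * (k + j) + 1) * exp (- r * u\<^sup>2))" for k
      using C False by simp
    have "(\<lambda>k. ennreal (C k * (2 * u ^ (2 * (k + j) + 1) * exp (- r * u\<^sup>2)))) sums
        ennreal (trans_density \<alpha> v u * (u ^ (2 * j) * exp (- s * u\<^sup>2)))"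
      using nn sm trans_density_nonneg[OF \<alpha>] False by (subst sums_ennreal) auto
    then show ?thesis
      using False C by (simp add: sums_iff ennreal_mult)
  qed
  have "(\<integral>\<^sup>+u. ennreal (trans_density \<alpha> v u * (u ^ (2 * j) * exp (- s * u\<^sup>2))) \<partial>lborel)
    = (\<Sum>k. \<integral>\<^sup>+u. ennreal (C k) * (ennreal (2 * u ^ (2 * (k + j) + 1) * exp (- r * u\<^sup>2)) * indicator {0..} u) \<partial>lborel)"
    unfolding pw by (rule nn_integral_suminf) measurable
  also have "\<dots> = (\<Sum>k. ennreal (C k * (fact (k + j) / r ^ (k + j + 1))))"
  proof (rule suminf_cong)
    fix k
    have "(\<integral>\<^sup>+u. ennreal (C k) * (ennreal (2 * u ^ (2 * (k + j) + 1) * exp (- r * u\<^sup>2)) * indicator {0..} u) \<partial>lborel)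
      = ennreal (C k) * ennreal (fact (k + j) / r ^ (k + j + 1))"
      unfolding nn_integral_odd_moment[OF r, symmetric] by (rule nn_integral_cmult) measurable
    also have "\<dots> = ennreal (C k * (fact (k + j) / r ^ (k + j + 1)))"
      using C r by (intro ennreal_mult[symmetric]) auto
    finally show "(\<integral>\<^sup>+u. ennreal (C k) * (ennreal (2 * u ^ (2 * (k + j) + 1) * exp (- r * u\<^sup>2)) * indicator {0..} u) \<partial>lborel)
      = ennreal (C k * (fact (k + j) / r ^ (k + j + 1)))" .
  qed
  finally show ?thesis unfolding C_def r_def .
qed

text \<open>For \<open>j = 0\<close> the factorial of the moment cancels one of the two in the
  Bessel coefficient, and an exponential series remains. The squared gain is a scaled noncentral
  chi-square variable with two degrees of freedom, and this is its Laplace transform.\<close>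

lemma nn_integral_trans_density_exp:
  assumes \<alpha>: "0 < \<alpha>" "\<alpha> < 1" and s: "s \<ge> 0"
  shows "(\<integral>\<^sup>+u. ennreal (trans_density \<alpha> v u * exp (- s * u\<^sup>2)) \<partial>lborel)
    = ennreal (exp (- (s * \<alpha>\<^sup>2 * v\<^sup>2 / (1 + s * (1 - \<alpha>\<^sup>2)))) / (1 + s * (1 - \<alpha>\<^sup>2)))"
proof -
  define \<sigma> where "\<sigma> = 1 - \<alpha>\<^sup>2"
  have \<sigma>: "\<sigma> > 0" unfolding \<sigma>_def using \<alpha> by (simp add: power_less_one_iff abs_square_less_1)
  define r where "r = 1 / \<sigma> + s"
  have r: "r > 0" unfolding r_def using \<sigma> s by (simp add: add_pos_nonneg)
  define c where "c = exp (- (\<alpha>\<^sup>2 * v\<^sup>2 / \<sigma>)) / (\<sigma> * r)"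
  define q where "q = (\<alpha> * v / \<sigma>)\<^sup>2 / r"
  have \<sigma>r: "\<sigma> * r = 1 + s * \<sigma>" unfolding r_def using \<sigma> by (simp add: field_simps)
  have "(\<integral>\<^sup>+u. ennreal (trans_density \<alpha> v u * exp (- s * u\<^sup>2)) \<partial>lborel)
    = (\<Sum>k. ennreal (exp (- (\<alpha>\<^sup>2 * v\<^sup>2 / \<sigma>)) / \<sigma> * ((\<alpha> * v / \<sigma>)\<^sup>2) ^ k / (fact k)\<^sup>2 * (fact (k + 0) / r ^ (k + 0 + 1))))"
    using nn_integral_trans_density_series[OF \<alpha> s, where v = v and j = 0]
    unfolding \<sigma>_def[symmetric] r_def[symmetric] by simp
  also have "\<dots> = (\<Sum>k. ennreal (c * (q ^ k /\<^sub>R fact k)))"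
    using r by (intro suminf_cong arg_cong[where f = ennreal])
      (simp add: c_def q_def power_divide field_simps power2_eq_square)
  also have "\<dots> = ennreal (c * exp q)"
  proof -
    have "(\<lambda>k. ennreal (c * (q ^ k /\<^sub>R fact k))) sums ennreal (c * exp q)"
    proof (subst sums_ennreal)
      show "(\<lambda>k. c * (q ^ k /\<^sub>R fact k)) sums (c * exp q)" by (intro sums_mult exp_converges)
    qed (use \<sigma> r in \<open>auto simp: c_def q_def\<close>)
    then show ?thesis by (simp add: sums_iff)
  qed
  also have "c * exp q = exp (q - \<alpha>\<^sup>2 * v\<^sup>2 / \<sigma>) / (1 + s * \<sigma>)"
    unfolding c_def \<sigma>r by (simp add: exp_diff exp_minus field_simps)
  also have "q - \<alpha>\<^sup>2 * v\<^sup>2 / \<sigma> = - (s * \<alpha>\<^sup>2 * v\<^sup>2 / (1 + s * \<sigma>))"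
  proof -
    have "q = \<alpha>\<^sup>2 * v\<^sup>2 / (\<sigma> * (\<sigma> * r))"
      unfolding q_def by (simp add: power_divide power_mult_distrib power2_eq_square mult_ac)
    moreover have "1 + s * \<sigma> > 0" using \<sigma> s by (simp add: add_pos_nonneg)
    ultimately show ?thesis unfolding \<sigma>r using \<sigma> by (simp add: divide_simps) (simp add: algebra_simps)
  qed
  finally show ?thesis unfolding \<sigma>_def .
qed

lemma nn_integral_trans_density:
  assumes "0 < \<alpha>" "\<alpha> < 1"
  shows "(\<integral>\<^sup>+u. ennreal (trans_density \<alpha> v u) \<partial>lborel) = 1"
  using nn_integral_trans_density_exp[OF assms, of 0 v] by simp

text \<open>Since (k+1)! / (k!)^2 = (k+1) / k!, the series is \<sigma> times the mean of one plus a
  Poisson variable with parameter \<open>q\<close>, that is \<sigma> (q + 1), where \<sigma> q =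
  \<alpha>^2 v^2.\<close>

lemma nn_integral_trans_density_power2:
  assumes \<alpha>: "0 < \<alpha>" "\<alpha> < 1"
  shows "(\<integral>\<^sup>+u. ennreal (trans_density \<alpha> v u * u\<^sup>2) \<partial>lborel) = ennreal (\<alpha>\<^sup>2 * v\<^sup>2 + (1 - \<alpha>\<^sup>2))"
proof -
  define \<sigma> where "\<sigma> = 1 - \<alpha>\<^sup>2"
  have \<sigma>: "\<sigma> > 0" unfolding \<sigma>_def using \<alpha> by (simp add: power_less_one_iff abs_square_less_1)
  define q where "q = \<alpha>\<^sup>2 * v\<^sup>2 / \<sigma>"
  have q: "q \<ge> 0" unfolding q_def using \<sigma> by simp
  have "(\<integral>\<^sup>+u. ennreal (trans_density \<alpha> v u * u\<^sup>2) \<partial>lborel)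
    = (\<Sum>k. ennreal (exp (- q) / \<sigma> * ((\<alpha> * v / \<sigma>)\<^sup>2) ^ k / (fact k)\<^sup>2 * (fact (k + 1) / (1 / \<sigma>) ^ (k + 1 + 1))))"
    using nn_integral_trans_density_series[OF \<alpha> order.refl, where v = v and j = 1]
    unfolding \<sigma>_def[symmetric] q_def[symmetric] by simp
  also have "\<dots> = (\<Sum>k. ennreal (exp (- q) * \<sigma> * (real (k + 1) * (q ^ k /\<^sub>R fact k))))"
  proof (intro suminf_cong arg_cong[where f = ennreal])
    fix k
    have "((\<alpha> * v / \<sigma>)\<^sup>2) ^ k * \<sigma> ^ k = q ^ k"
      unfolding q_def power_mult_distrib[symmetric] using \<sigma>
      by (simp add: power2_eq_square field_simps)
    moreover have "fact (k + 1) / (fact k)\<^sup>2 = real (k + 1) / fact k"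
      by (simp add: power2_eq_square)
    moreover have "exp (- q) / \<sigma> * ((\<alpha> * v / \<sigma>)\<^sup>2) ^ k / (fact k)\<^sup>2 * (fact (k + 1) / (1 / \<sigma>) ^ (k + 1 + 1))
       = exp (- q) * \<sigma> * (fact (k + 1) / (fact k)\<^sup>2) * (((\<alpha> * v / \<sigma>)\<^sup>2) ^ k * \<sigma> ^ k)"
      using \<sigma> by (simp add: power_divide power2_eq_square field_simps)
    ultimately have "exp (- q) / \<sigma> * ((\<alpha> * v / \<sigma>)\<^sup>2) ^ k / (fact k)\<^sup>2 * (fact (k + 1) / (1 / \<sigma>) ^ (k + 1 + 1))
       = exp (- q) * \<sigma> * (real (k + 1) / fact k) * q ^ k" by metis
    then show "exp (- q) / \<sigma> * ((\<alpha> * v / \<sigma>)\<^sup>2) ^ k / (fact k)\<^sup>2 * (fact (k + 1) / (1 / \<sigma>) ^ (k + 1 + 1))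
       = exp (- q) * \<sigma> * (real (k + 1) * (q ^ k /\<^sub>R fact k))"
      by (simp add: divide_inverse)
  qed
  also have "\<dots> = ennreal (exp (- q) * \<sigma> * (q * exp q + exp q))"
  proof -
    have 1: "(\<lambda>k. q ^ k /\<^sub>R fact k) sums exp q" by (rule exp_converges)
    have "(\<lambda>k. q * (q ^ k /\<^sub>R fact k)) sums (q * exp q)" by (intro sums_mult 1)
    also have "(\<lambda>k. q * (q ^ k /\<^sub>R fact k)) = (\<lambda>k. real (Suc k) * (q ^ Suc k /\<^sub>R fact (Suc k)))"
      by (auto simp: fact_Suc divide_simps simp del: of_nat_Suc)
    finally have "(\<lambda>k. real k * (q ^ k /\<^sub>R fact k)) sums (q * exp q)"
      using sums_Suc_iff[where f = "\<lambda>k. real k * (q ^ k /\<^sub>R fact k)"] by simp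
    from sums_add[OF this 1] have "(\<lambda>k. real (k + 1) * (q ^ k /\<^sub>R fact k)) sums (q * exp q + exp q)"
      by (simp add: algebra_simps)
    then have "(\<lambda>k. exp (- q) * \<sigma> * (real (k + 1) * (q ^ k /\<^sub>R fact k))) sums (exp (- q) * \<sigma> * (q * exp q + exp q))"
      by (rule sums_mult)
    then have "(\<lambda>k. ennreal (exp (- q) * \<sigma> * (real (k + 1) * (q ^ k /\<^sub>R fact k)))) sums ennreal (exp (- q) * \<sigma> * (q * exp q + exp q))"
      using \<sigma> q by (subst sums_ennreal) auto
    then show ?thesis by (simp add: sums_iff)
  qed
  also have "exp (- q) * \<sigma> * (q * exp q + exp q) = \<alpha>\<^sup>2 * v\<^sup>2 + \<sigma>"
    using \<sigma> by (simp add: q_def exp_minus field_simps)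
  finally show ?thesis unfolding \<sigma>_def .
qed

section \<open>The law of the gains\<close>

text \<open>The index 0 lies outside the product; the update makes it the constant
  \<open>u0\<close>, so that the first step can be treated like every other one.\<close>

lemma measurable_gain_component [measurable]:
  fixes j N :: nat
  assumes "j \<le> N"
  shows "(\<lambda>w. (w(0 := u0)) j) \<in> borel_measurable (Pi\<^sub>M {1..N} (\<lambda>_. lborel))"
  using assms by (cases "j = 0") auto

lemma sets_gain_law [measurable_cong]: "sets (gain_law u0 \<alpha> N) = sets (Pi\<^sub>M {1..N} (\<lambda>_. lborel))"
  by (simp add: gain_law_def)

interpretation lborel_prod: product_sigma_finite "\<lambda>_::nat. lborel :: real measure"
  by standard

text \<open>The Markov property: the last coordinate enters the joint density through its own
  transition factor only, so it can be integrated out with the earlier ones held fixed. The later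
  inductions over the codeword length rest on this.\<close>

lemma nn_integral_gain_law_Suc:
  assumes \<alpha>: "0 < \<alpha>" "\<alpha> < 1"
    and g [measurable]: "g \<in> borel_measurable (Pi\<^sub>M {1..Suc N} (\<lambda>_. lborel :: real measure))"
  shows "(\<integral>\<^sup>+w. g w \<partial>gain_law u0 \<alpha> (Suc N)) =
    (\<integral>\<^sup>+w. (\<integral>\<^sup>+u. ennreal (trans_density \<alpha> ((w(0 := u0)) N) u) * g (w(Suc N := u)) \<partial>lborel) \<partial>gain_law u0 \<alpha> N)"
proof -
  let ?d = "\<lambda>N w. (\<Prod>i\<in>{1..N::nat}. trans_density \<alpha> ((w(0 := u0)) (i - 1)) (w i))"
  let ?M = "\<lambda>N. Pi\<^sub>M {1..N::nat} (\<lambda>_. lborel :: real measure)"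
  have ins: "{1..Suc N} = insert (Suc N) {1..N}" by auto
  have meas_d [measurable]: "?d N \<in> borel_measurable (?M N)" for N
  proof (intro borel_measurable_prod measurable_trans_density)
    fix i assume "i \<in> {1..N}"
    then show "(\<lambda>w. w i) \<in> borel_measurable (?M N)" by auto
    have "i - 1 \<le> N" using \<open>i \<in> {1..N}\<close> by auto
    then show "(\<lambda>w. (w(0 := u0)) (i - 1)) \<in> borel_measurable (?M N)"
      by (rule measurable_gain_component)
  qed
  have upd: "(\<lambda>p. (fst p)(Suc N := snd p)) \<in> ?M N \<Otimes>\<^sub>M lborel \<rightarrow>\<^sub>M ?M (Suc N)"
    unfolding ins by (intro measurable_fun_upd[where J = "{1..N}"]) auto
  have g2 [measurable]: "(\<lambda>p. g ((fst p)(Suc N := snd p))) \<in> borel_measurable (?M N \<Otimes>\<^sub>M lborel)"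
    by (rule measurable_compose[OF upd g])
  have gm [measurable]: "(\<lambda>u. g (w(Suc N := u))) \<in> borel_measurable lborel" if "w \<in> space (?M N)" for w
    using measurable_compose[OF measurable_Pair1'[OF that] g2] by simp
  have c2: "(\<lambda>p. ((fst p)(0 := u0)) N) \<in> borel_measurable (?M N \<Otimes>\<^sub>M lborel)"
    by (rule measurable_compose[OF measurable_fst measurable_gain_component]) simp
  have q2 [measurable]: "(\<lambda>p. trans_density \<alpha> (((fst p)(0 := u0)) N) (snd p)) \<in> borel_measurable (?M N \<Otimes>\<^sub>M lborel)"
    by (intro measurable_trans_density c2) auto
  have inner: "(\<lambda>w. \<integral>\<^sup>+u. ennreal (trans_density \<alpha> ((w(0 := u0)) N) u) * g (w(Suc N := u)) \<partial>lborel) \<in> borel_measurable (?M N)"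
    using lborel.borel_measurable_nn_integral_fst[OF borel_measurable_times_ennreal[OF measurable_compose[OF q2 measurable_ennreal] g2]]
    by (simp only: fst_conv snd_conv)
  have dg: "(\<lambda>w. ennreal (?d (Suc N) w) * g w) \<in> borel_measurable (?M (Suc N))"
    by (rule borel_measurable_times_ennreal[OF measurable_compose[OF meas_d measurable_ennreal] g])
  have "(\<integral>\<^sup>+w. g w \<partial>gain_law u0 \<alpha> (Suc N)) = (\<integral>\<^sup>+w. ennreal (?d (Suc N) w) * g w \<partial>?M (Suc N))"
    unfolding gain_law_def by (rule nn_integral_density[OF measurable_compose[OF meas_d measurable_ennreal] g])
  also have "\<dots> = (\<integral>\<^sup>+w. (\<integral>\<^sup>+u. ennreal (?d (Suc N) (w(Suc N := u))) * g (w(Suc N := u)) \<partial>lborel) \<partial>?M N)"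
    unfolding ins
    by (rule lborel_prod.product_nn_integral_insert[OF _ _ dg[unfolded ins]]) auto
  also have "\<dots> = (\<integral>\<^sup>+w. ennreal (?d N w) * (\<integral>\<^sup>+u. ennreal (trans_density \<alpha> ((w(0 := u0)) N) u) * g (w(Suc N := u)) \<partial>lborel) \<partial>?M N)"
  proof (rule nn_integral_cong)
    fix w assume w: "w \<in> space (?M N)"
    have "?d (Suc N) (w(Suc N := u)) = ?d N w * trans_density \<alpha> ((w(0 := u0)) N) u" for u
    proof -
      have "?d (Suc N) (w(Suc N := u)) = trans_density \<alpha> (((w(Suc N := u))(0 := u0)) N) u *
         (\<Prod>i\<in>{1..N}. trans_density \<alpha> (((w(Suc N := u))(0 := u0)) (i - 1)) ((w(Suc N := u)) i))"
        unfolding ins by (subst prod.insert) auto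
      also have "(\<Prod>i\<in>{1..N}. trans_density \<alpha> (((w(Suc N := u))(0 := u0)) (i - 1)) ((w(Suc N := u)) i)) = ?d N w"
        by (intro prod.cong refl) auto
      also have "((w(Suc N := u))(0 := u0)) N = (w(0 := u0)) N" by simp
      finally show ?thesis by (simp only: mult.commute)
    qed
    then have "ennreal (?d (Suc N) (w(Suc N := u))) = ennreal (?d N w) * ennreal (trans_density \<alpha> ((w(0 := u0)) N) u)" for u
      by (simp only: ennreal_mult[OF prod_nonneg[OF trans_density_nonneg[OF \<alpha>]] trans_density_nonneg[OF \<alpha>]])
    then show "(\<integral>\<^sup>+u. ennreal (?d (Suc N) (w(Suc N := u))) * g (w(Suc N := u)) \<partial>lborel) =
        ennreal (?d N w) * (\<integral>\<^sup>+u. ennreal (trans_density \<alpha> ((w(0 := u0)) N) u) * g (w(Suc N := u)) \<partial>lborel)"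
      using w by (subst nn_integral_cmult[symmetric]) (auto simp: mult.assoc)
  qed
  also have "\<dots> = (\<integral>\<^sup>+w. (\<integral>\<^sup>+u. ennreal (trans_density \<alpha> ((w(0 := u0)) N) u) * g (w(Suc N := u)) \<partial>lborel) \<partial>gain_law u0 \<alpha> N)"
    unfolding gain_law_def by (rule nn_integral_density[OF measurable_compose[OF meas_d measurable_ennreal] inner, symmetric])
  finally show ?thesis .
qed

text \<open>The empty product space consists of one point with an irrelevant default value;
  evaluating its update \<open>(0 := u0)\<close> at 0 still yields \<open>u0\<close>, which is what
  the base cases need.\<close>

lemma nn_integral_gain_law_0: "(\<integral>\<^sup>+w. g w \<partial>gain_law u0 \<alpha> 0) = g (\<lambda>_. undefined)"
proof -
  have "gain_law u0 \<alpha> 0 = count_space {\<lambda>_. undefined}"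
    unfolding gain_law_def by (simp add: PiM_empty density_1)
  then show ?thesis by (simp add: nn_integral_count_space_finite)
qed

lemma nn_integral_gain_law_const:
  assumes "0 < \<alpha>" "\<alpha> < 1"
  shows "(\<integral>\<^sup>+w. c \<partial>gain_law u0 \<alpha> N) = c"
proof (induction N)
  case (Suc N)
  have "(\<integral>\<^sup>+u. ennreal (trans_density \<alpha> v u) * c \<partial>lborel) = c" for v
    by (subst nn_integral_multc) (auto simp: nn_integral_trans_density[OF assms])
  then show ?case using Suc by (subst nn_integral_gain_law_Suc[OF assms]) (simp_all del: nn_integral_const)
qed (simp add: nn_integral_gain_law_0 del: nn_integral_const)

lemma prob_space_gain_law:
  assumes "0 < \<alpha>" "\<alpha> < 1"
  shows "prob_space (gain_law u0 \<alpha> N)"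
  using nn_integral_gain_law_const[OF assms, of u0 N 1] by (intro prob_spaceI) simp

text \<open>One step maps a mean m to \<alpha>^2 m + (1 - \<alpha>^2), whose fixed point is 1; hence
  the geometric interpolation between u0^2 and 1. The index 0 is included because it is the
  predecessor of the first step.\<close>

lemma nn_integral_gain_law_power2:
  assumes \<alpha>: "0 < \<alpha>" "\<alpha> < 1" and "i \<le> N"
  shows "(\<integral>\<^sup>+w. ennreal (((w(0 := u0)) i)\<^sup>2) \<partial>gain_law u0 \<alpha> N)
    = ennreal (\<alpha> ^ (2 * i) * u0\<^sup>2 + (1 - \<alpha> ^ (2 * i)))"
  using \<open>i \<le> N\<close>
proof (induction N arbitrary: i)
  case 0
  then show ?case by (simp add: nn_integral_gain_law_0 del: nn_integral_const)
next
  case (Suc N)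
  have m: "(\<lambda>w. ennreal (((w(0 := u0)) i)\<^sup>2)) \<in> borel_measurable (Pi\<^sub>M {1..Suc N} (\<lambda>_. lborel))"
    using measurable_gain_component[OF Suc.prems] by measurable
  have "(\<integral>\<^sup>+w. ennreal (((w(0 := u0)) i)\<^sup>2) \<partial>gain_law u0 \<alpha> (Suc N)) =
     (\<integral>\<^sup>+w. (\<integral>\<^sup>+u. ennreal (trans_density \<alpha> ((w(0 := u0)) N) u) * ennreal (((w(Suc N := u, 0 := u0)) i)\<^sup>2) \<partial>lborel) \<partial>gain_law u0 \<alpha> N)"
    by (rule nn_integral_gain_law_Suc[OF \<alpha> m])
  also have "\<dots> = ennreal (\<alpha> ^ (2 * i) * u0\<^sup>2 + (1 - \<alpha> ^ (2 * i)))"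
  proof (cases "i = Suc N")
    case False
    then have e: "(w(Suc N := u, 0 := u0)) i = (w(0 := u0)) i" for w :: "nat \<Rightarrow> real" and u by simp
    have "(\<integral>\<^sup>+u. ennreal (trans_density \<alpha> v u) * c \<partial>lborel) = c" for v c
      by (subst nn_integral_multc) (auto simp: nn_integral_trans_density[OF \<alpha>])
    then show ?thesis unfolding e using Suc.IH[of i] False Suc.prems by simp
  next
    case True
    have "(\<integral>\<^sup>+u. ennreal (trans_density \<alpha> v u) * ennreal (((w(Suc N := u, 0 := u0)) i)\<^sup>2) \<partial>lborel)
       = ennreal (\<alpha>\<^sup>2) * ennreal (v\<^sup>2) + ennreal (1 - \<alpha>\<^sup>2)" for v and w :: "nat \<Rightarrow> real"
    proof -
      have "(\<integral>\<^sup>+u. ennreal (trans_density \<alpha> v u) * ennreal (((w(Suc N := u, 0 := u0)) i)\<^sup>2) \<partial>lborel)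
         = (\<integral>\<^sup>+u. ennreal (trans_density \<alpha> v u * u\<^sup>2) \<partial>lborel)"
        using True by (intro nn_integral_cong) (simp add: ennreal_mult trans_density_nonneg[OF \<alpha>])
      also have "\<dots> = ennreal (\<alpha>\<^sup>2 * v\<^sup>2 + (1 - \<alpha>\<^sup>2))" by (rule nn_integral_trans_density_power2[OF \<alpha>])
      also have "\<dots> = ennreal (\<alpha>\<^sup>2) * ennreal (v\<^sup>2) + ennreal (1 - \<alpha>\<^sup>2)"
        using \<alpha> by (simp add: ennreal_plus ennreal_mult power_le_one)
      finally show ?thesis .
    qed
    then have "(\<integral>\<^sup>+w. (\<integral>\<^sup>+u. ennreal (trans_density \<alpha> ((w(0 := u0)) N) u) * ennreal (((w(Suc N := u, 0 := u0)) i)\<^sup>2) \<partial>lborel) \<partial>gain_law u0 \<alpha> N)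
      = (\<integral>\<^sup>+w. ennreal (\<alpha>\<^sup>2) * ennreal (((w(0 := u0)) N)\<^sup>2) + ennreal (1 - \<alpha>\<^sup>2) \<partial>gain_law u0 \<alpha> N)"
      by simp
    also have "\<dots> = (\<integral>\<^sup>+w. ennreal (\<alpha>\<^sup>2) * ennreal (((w(0 := u0)) N)\<^sup>2) \<partial>gain_law u0 \<alpha> N) + (\<integral>\<^sup>+w. ennreal (1 - \<alpha>\<^sup>2) \<partial>gain_law u0 \<alpha> N)"
      by (rule nn_integral_add) (use measurable_gain_component[of N N u0] in measurable)
    also have "(\<integral>\<^sup>+w. ennreal (\<alpha>\<^sup>2) * ennreal (((w(0 := u0)) N)\<^sup>2) \<partial>gain_law u0 \<alpha> N)
       = ennreal (\<alpha>\<^sup>2) * (\<integral>\<^sup>+w. ennreal (((w(0 := u0)) N)\<^sup>2) \<partial>gain_law u0 \<alpha> N)"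
      by (rule nn_integral_cmult) (use measurable_gain_component[of N N u0] in measurable)
    also have "(\<integral>\<^sup>+w. ennreal (((w(0 := u0)) N)\<^sup>2) \<partial>gain_law u0 \<alpha> N) = ennreal (\<alpha> ^ (2 * N) * u0\<^sup>2 + (1 - \<alpha> ^ (2 * N)))"
      by (rule Suc.IH) simp
    also have "(\<integral>\<^sup>+w. ennreal (1 - \<alpha>\<^sup>2) \<partial>gain_law u0 \<alpha> N) = ennreal (1 - \<alpha>\<^sup>2)"
      by (rule nn_integral_gain_law_const[OF \<alpha>])
    also have "ennreal (\<alpha>\<^sup>2) * ennreal (\<alpha> ^ (2 * N) * u0\<^sup>2 + (1 - \<alpha> ^ (2 * N))) + ennreal (1 - \<alpha>\<^sup>2)
      = ennreal (\<alpha>\<^sup>2 * (\<alpha> ^ (2 * N) * u0\<^sup>2 + (1 - \<alpha> ^ (2 * N))) + (1 - \<alpha>\<^sup>2))"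
      using \<alpha> by (subst ennreal_mult[symmetric]) (auto simp: power_le_one intro!: ennreal_plus[symmetric] add_nonneg_nonneg)
    also have "\<alpha>\<^sup>2 * (\<alpha> ^ (2 * N) * u0\<^sup>2 + (1 - \<alpha> ^ (2 * N))) + (1 - \<alpha>\<^sup>2) = \<alpha> ^ (2 * i) * u0\<^sup>2 + (1 - \<alpha> ^ (2 * i))"
      using True by (simp add: power_add algebra_simps power2_eq_square)
    finally show ?thesis .
  qed
  finally show ?case .
qed

section \<open>Chernoff bound for the decay of the gains\<close>

lemma trans_density_lower_tail:
  assumes \<alpha>: "0 < \<alpha>" "\<alpha> < 1" and \<tau>: "0 < \<tau>" "\<tau> < 1" and z: "0 \<le> z" "z \<le> v\<^sup>2"
  shows "(\<integral>\<^sup>+u. ennreal (trans_density \<alpha> v u) * indicator {u. u\<^sup>2 < (1 - \<tau>) * \<alpha>\<^sup>2 * z} u \<partial>lborel)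
    \<le> ennreal (exp (- (\<tau>\<^sup>2 / 4 * (\<alpha>\<^sup>2 * z))))"
proof -
  define \<sigma> where "\<sigma> = 1 - \<alpha>\<^sup>2"
  have \<sigma>: "\<sigma> > 0" "\<sigma> \<le> 1" unfolding \<sigma>_def using \<alpha> by (auto simp: power_less_one_iff abs_square_less_1)
  \<comment> \<open>With this Chernoff parameter the denominator 1 + s \<sigma> of the Laplace
    transform becomes 1 + \<tau> / 2, free of \<alpha>; moreover s >= \<tau> / 2 because \<sigma> <=
    1. So the bound does not deteriorate as \<alpha> approaches 0 or 1, apart from the factor
    \<alpha>^2 in the exponent.\<close>
  define s where "s = \<tau> / (2 * \<sigma>)"
  have s: "s \<ge> 0" unfolding s_def using \<sigma> \<tau> by simp
  have s\<sigma>: "s * \<sigma> = \<tau> / 2" unfolding s_def using \<sigma> by simp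
  let ?t = "(1 - \<tau>) * \<alpha>\<^sup>2 * z"
  have "(\<integral>\<^sup>+u. ennreal (trans_density \<alpha> v u) * indicator {u. u\<^sup>2 < ?t} u \<partial>lborel)
     \<le> (\<integral>\<^sup>+u. ennreal (exp (s * ?t)) * ennreal (trans_density \<alpha> v u * exp (- s * u\<^sup>2)) \<partial>lborel)"
  proof (rule nn_integral_mono)
    fix u :: real
    show "ennreal (trans_density \<alpha> v u) * indicator {u. u\<^sup>2 < ?t} u \<le> ennreal (exp (s * ?t)) * ennreal (trans_density \<alpha> v u * exp (- s * u\<^sup>2))"
    proof (cases "u\<^sup>2 < ?t")
      case True
      then have "s * u\<^sup>2 \<le> s * ?t" using s by (intro mult_left_mono) auto
      then have "1 \<le> exp (s * ?t) * exp (- s * u\<^sup>2)" by (simp add: exp_add[symmetric])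
      then have "trans_density \<alpha> v u * 1 \<le> trans_density \<alpha> v u * (exp (s * ?t) * exp (- s * u\<^sup>2))"
        by (intro mult_left_mono trans_density_nonneg[OF \<alpha>])
      then have "trans_density \<alpha> v u \<le> exp (s * ?t) * (trans_density \<alpha> v u * exp (- s * u\<^sup>2))"
        by (simp add: mult_ac)
      then show ?thesis using True trans_density_nonneg[OF \<alpha>, of v u]
        by (simp add: ennreal_mult[symmetric] ennreal_leI)
    qed simp
  qed
  also have "\<dots> = ennreal (exp (s * ?t)) * ennreal (exp (- (s * \<alpha>\<^sup>2 * v\<^sup>2 / (1 + s * (1 - \<alpha>\<^sup>2)))) / (1 + s * (1 - \<alpha>\<^sup>2)))"
    by (subst nn_integral_cmult) (auto simp: nn_integral_trans_density_exp[OF \<alpha> s, simplified])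
  also have "\<dots> = ennreal (exp (s * ?t) * (exp (- (s * \<alpha>\<^sup>2 * v\<^sup>2 / (1 + \<tau> / 2))) / (1 + \<tau> / 2)))"
    unfolding \<sigma>_def[symmetric] s\<sigma> using \<tau> by (intro ennreal_mult[symmetric]) auto
  also have "\<dots> \<le> ennreal (exp (- (\<tau>\<^sup>2 / 4 * (\<alpha>\<^sup>2 * z))))"
  proof (rule ennreal_leI)
    have "exp (s * ?t) * (exp (- (s * \<alpha>\<^sup>2 * v\<^sup>2 / (1 + \<tau> / 2))) / (1 + \<tau> / 2)) \<le> exp (s * ?t) * exp (- (s * \<alpha>\<^sup>2 * v\<^sup>2 / (1 + \<tau> / 2)))"
      using \<tau> by (intro mult_left_mono) (auto simp: divide_le_eq mult_le_cancel_left1)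
    also have "\<dots> = exp (s * ?t - s * \<alpha>\<^sup>2 * v\<^sup>2 / (1 + \<tau> / 2))" by (simp add: exp_add[symmetric])
    also have "\<dots> \<le> exp (- (\<tau>\<^sup>2 / 4 * (\<alpha>\<^sup>2 * z)))"
    proof (subst exp_le_cancel_iff)
      have p: "0 \<le> \<alpha>\<^sup>2 * z" using z by simp
      \<comment> \<open>From 1 / (1 + \<tau> / 2) >= 1 - \<tau> / 2: the transform contributes at
        least 1 - \<tau> / 2 against the 1 - \<tau> of the threshold, and the surplus \<tau> / 2 is
        the exponent that remains.\<close>
      have "s * (\<alpha>\<^sup>2 * z) * (1 - \<tau> / 2) \<le> s * (\<alpha>\<^sup>2 * v\<^sup>2) * (1 / (1 + \<tau> / 2))"
        using \<tau> s z p by (intro mult_mono) (auto simp: field_simps)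
      then have "s * ?t - s * \<alpha>\<^sup>2 * v\<^sup>2 / (1 + \<tau> / 2) \<le> s * ?t - s * (\<alpha>\<^sup>2 * z) * (1 - \<tau> / 2)"
        by (simp add: mult_ac)
      also have "\<dots> = - (s * \<tau> / 2 * (\<alpha>\<^sup>2 * z))" by (simp add: algebra_simps)
      also have "\<dots> \<le> - (\<tau>\<^sup>2 / 4 * (\<alpha>\<^sup>2 * z))"
      proof -
        have "\<tau> / 2 \<le> s" unfolding s_def using \<sigma> \<tau> by (simp add: field_simps)
        then have "\<tau> / 2 * (\<tau> / 2) \<le> s * (\<tau> / 2)" using \<tau> by (intro mult_right_mono) auto
        then have "\<tau>\<^sup>2 / 4 * (\<alpha>\<^sup>2 * z) \<le> s * \<tau> / 2 * (\<alpha>\<^sup>2 * z)"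
          using p by (intro mult_right_mono) (auto simp: power2_eq_square)
        then show ?thesis by simp
      qed
      finally show "s * ?t - s * \<alpha>\<^sup>2 * v\<^sup>2 / (1 + \<tau> / 2) \<le> - (\<tau>\<^sup>2 / 4 * (\<alpha>\<^sup>2 * z))" .
    qed
    finally show "exp (s * ?t) * (exp (- (s * \<alpha>\<^sup>2 * v\<^sup>2 / (1 + \<tau> / 2))) / (1 + \<tau> / 2)) \<le> exp (- (\<tau>\<^sup>2 / 4 * (\<alpha>\<^sup>2 * z)))" .
  qed
  finally show ?thesis .
qed

lemma measurable_gain_threshold [measurable]:
  fixes N :: nat
  shows "Measurable.pred (Pi\<^sub>M {1..N} (\<lambda>_. lborel :: real measure)) (\<lambda>w. \<exists>i\<in>{1..N}. (w i)\<^sup>2 < b i)"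
  by measurable

text \<open>A union bound over the first failure: as long as the path stays above the geometric
  curve \<beta>^i u0^2, the next step fails only if it loses more than the factor \<beta> relative
  to that curve, to which the one-step bound applies. The curve decreases, so the estimate at time
  \<open>N\<close> is the weakest and serves for all \<open>N\<close> steps.\<close>

lemma gain_law_lower_tail:
  assumes \<alpha>: "0 < \<alpha>" "\<alpha> < 1" and \<tau>: "0 < \<tau>" "\<tau> < 1"
  defines "\<beta> \<equiv> (1 - \<tau>) * \<alpha>\<^sup>2"
  shows "(\<integral>\<^sup>+w. indicator {w. \<exists>i\<in>{1..N}. (w i)\<^sup>2 < \<beta> ^ i * u0\<^sup>2} w \<partial>gain_law u0 \<alpha> N)
    \<le> ennreal (real N * exp (- (\<tau>\<^sup>2 / 4 * (\<beta> ^ N * u0\<^sup>2))))"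
proof (induction N)
  case 0
  show ?case by (simp add: nn_integral_gain_law_0)
next
  case (Suc N)
  have "(1 - \<tau>) * \<alpha>\<^sup>2 \<le> 1 * 1" using \<alpha> \<tau> by (intro mult_mono) (auto simp: power_le_one)
  then have \<beta>: "0 \<le> \<beta>" "\<beta> \<le> \<alpha>\<^sup>2" "\<beta> \<le> 1" unfolding \<beta>_def using \<alpha> \<tau> by (auto simp: mult_left_le_one_le)
  let ?B = "\<lambda>N. {w. \<exists>i\<in>{1..N}. (w i)\<^sup>2 < \<beta> ^ i * u0\<^sup>2}"
  let ?e = "exp (- (\<tau>\<^sup>2 / 4 * (\<beta> ^ Suc N * u0\<^sup>2)))"
  have m: "(\<lambda>w. indicator (?B N) w :: ennreal) \<in> borel_measurable (Pi\<^sub>M {1..N} (\<lambda>_. lborel))" for N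
    by measurable
  have "(\<integral>\<^sup>+w. indicator (?B (Suc N)) w \<partial>gain_law u0 \<alpha> (Suc N)) =
     (\<integral>\<^sup>+w. (\<integral>\<^sup>+u. ennreal (trans_density \<alpha> ((w(0 := u0)) N) u) * indicator (?B (Suc N)) (w(Suc N := u)) \<partial>lborel) \<partial>gain_law u0 \<alpha> N)"
    by (rule nn_integral_gain_law_Suc[OF \<alpha> m])
  also have "\<dots> \<le> (\<integral>\<^sup>+w. indicator (?B N) w + ennreal ?e \<partial>gain_law u0 \<alpha> N)"
  proof (rule nn_integral_mono)
    fix w :: "nat \<Rightarrow> real"
    let ?v = "(w(0 := u0)) N"
    show "(\<integral>\<^sup>+u. ennreal (trans_density \<alpha> ?v u) * indicator (?B (Suc N)) (w(Suc N := u)) \<partial>lborel) \<le> indicator (?B N) w + ennreal ?e"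
    proof (cases "w \<in> ?B N")
      case True
      have "(\<integral>\<^sup>+u. ennreal (trans_density \<alpha> ?v u) * indicator (?B (Suc N)) (w(Suc N := u)) \<partial>lborel)
         \<le> (\<integral>\<^sup>+u. ennreal (trans_density \<alpha> ?v u) * 1 \<partial>lborel)"
        by (intro nn_integral_mono mult_left_mono) (auto simp: indicator_def)
      also have "\<dots> = 1" using nn_integral_trans_density[OF \<alpha>] by simp
      also have "1 \<le> indicator (?B N) w + ennreal ?e" using True by simp
      finally show ?thesis .
    next
      case False
      \<comment> \<open>No failure so far puts the predecessor above its threshold; for
        \<open>N = 0\<close> the predecessor is \<open>u0\<close>, and equality holds.\<close>
      have v: "\<beta> ^ N * u0\<^sup>2 \<le> ?v\<^sup>2"
        using False by (cases "N = 0") (auto simp: not_less)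
      have "(\<integral>\<^sup>+u. ennreal (trans_density \<alpha> ?v u) * indicator (?B (Suc N)) (w(Suc N := u)) \<partial>lborel)
        \<le> (\<integral>\<^sup>+u. ennreal (trans_density \<alpha> ?v u) * indicator {u. u\<^sup>2 < (1 - \<tau>) * \<alpha>\<^sup>2 * (\<beta> ^ N * u0\<^sup>2)} u \<partial>lborel)"
      proof (intro nn_integral_mono mult_left_mono)
        fix u :: real
        show "indicator (?B (Suc N)) (w(Suc N := u)) \<le> (indicator {u. u\<^sup>2 < (1 - \<tau>) * \<alpha>\<^sup>2 * (\<beta> ^ N * u0\<^sup>2)} u :: ennreal)"
          using False by (fastforce simp: indicator_def \<beta>_def mult_ac le_Suc_eq)
      qed simp
      also have "\<dots> \<le> ennreal (exp (- (\<tau>\<^sup>2 / 4 * (\<alpha>\<^sup>2 * (\<beta> ^ N * u0\<^sup>2)))))"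
        using \<beta> v by (intro trans_density_lower_tail \<alpha> \<tau>) auto
      also have "\<dots> \<le> ennreal ?e"
        using \<beta> \<tau> by (intro ennreal_leI) (auto simp: mult.assoc intro!: mult_right_mono mult_left_mono)
      finally show ?thesis using False by simp
    qed
  qed
  also have "\<dots> = (\<integral>\<^sup>+w. indicator (?B N) w \<partial>gain_law u0 \<alpha> N) + (\<integral>\<^sup>+w. ennreal ?e \<partial>gain_law u0 \<alpha> N)"
    by (rule nn_integral_add) (use m[of N] in measurable)
  also have "(\<integral>\<^sup>+w. ennreal ?e \<partial>gain_law u0 \<alpha> N) = ennreal ?e" by (rule nn_integral_gain_law_const[OF \<alpha>])
  also have "(\<integral>\<^sup>+w. indicator (?B N) w \<partial>gain_law u0 \<alpha> N) \<le> ennreal (real N * ?e)"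
  proof (rule order_trans[OF Suc.IH], rule ennreal_leI, rule mult_left_mono)
    have "\<beta> ^ Suc N * u0\<^sup>2 \<le> \<beta> ^ N * u0\<^sup>2"
      using \<beta> by (intro mult_right_mono power_decreasing) auto
    then show "exp (- (\<tau>\<^sup>2 / 4 * (\<beta> ^ N * u0\<^sup>2))) \<le> ?e"
      using \<tau> by (auto intro!: mult_left_mono)
  qed simp
  also have "ennreal (real N * ?e) + ennreal ?e = ennreal (real (Suc N) * ?e)"
    by (subst ennreal_plus[symmetric]) (auto simp: algebra_simps)
  finally show ?case by simp
qed

section \<open>Error exponent and throughput\<close>

text \<open>For N >= 1 this is exp (- N E_N), so the throughput can be handled without the logarithm
  of an integral.\<close>

definition gallager_integral :: "real \<Rightarrow> nat \<Rightarrow> real \<Rightarrow> real \<Rightarrow> real \<Rightarrow> real" where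
  "gallager_integral P N \<rho> u0 \<alpha> =
     (\<integral>u. (\<Prod>i\<in>{1..N}. (1 / (1 + P / (1 + \<rho>) * (u i)\<^sup>2)) powr \<rho>) \<partial>gain_law u0 \<alpha> N)"

text \<open>The sum of ln (1 + P m_i) with m_i the conditional mean of the i-th squared gain. It has
  \<open>P\<close> in place of P / (1 + \<rho>), so that a single number serves every
  \<rho>.\<close>

definition mean_log_sum :: "real \<Rightarrow> nat \<Rightarrow> real \<Rightarrow> real \<Rightarrow> real" where
  "mean_log_sum P N u0 \<alpha> = (\<Sum>i\<in>{1..N}. ln (1 + P * (\<alpha> ^ (2 * i) * u0\<^sup>2 + (1 - \<alpha> ^ (2 * i)))))"

lemma gallager_integrand_bounds:
  fixes u :: "nat \<Rightarrow> real"
  assumes "0 \<le> P" "0 \<le> \<rho>"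
  shows "0 \<le> (\<Prod>i\<in>A. (1 / (1 + P / (1 + \<rho>) * (u i)\<^sup>2)) powr \<rho>)"
    and "(\<Prod>i\<in>A. (1 / (1 + P / (1 + \<rho>) * (u i)\<^sup>2)) powr \<rho>) \<le> 1"
proof -
  show "0 \<le> (\<Prod>i\<in>A. (1 / (1 + P / (1 + \<rho>) * (u i)\<^sup>2)) powr \<rho>)"
    by (intro prod_nonneg) auto
  have "(1 / (1 + P / (1 + \<rho>) * (u i)\<^sup>2)) powr \<rho> \<le> 1" for i
  proof -
    have c: "0 \<le> P / (1 + \<rho>) * (u i)\<^sup>2" using assms by simp
    then have "1 / (1 + P / (1 + \<rho>) * (u i)\<^sup>2) \<le> 1" by (subst divide_le_eq_1_pos) auto
    with c show ?thesis by (intro powr_le1) (use assms in auto)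
  qed
  then show "(\<Prod>i\<in>A. (1 / (1 + P / (1 + \<rho>) * (u i)\<^sup>2)) powr \<rho>) \<le> 1"
    by (intro prod_le_1) auto
qed

lemma measurable_gallager_integrand [measurable]:
  fixes N :: nat
  shows "(\<lambda>u. \<Prod>i\<in>{1..N}. (1 / (1 + c * (u i)\<^sup>2)) powr \<rho>) \<in> borel_measurable (gain_law u0 \<alpha> N)"
proof (intro borel_measurable_prod)
  fix i assume "i \<in> {1..N}"
  then have "(\<lambda>u. u i) \<in> borel_measurable (gain_law u0 \<alpha> N)"
    by (simp add: measurable_cong_sets[OF sets_gain_law refl])
  then show "(\<lambda>u. (1 / (1 + c * (u i)\<^sup>2)) powr \<rho>) \<in> borel_measurable (gain_law u0 \<alpha> N)"
    by measurable
qed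

lemma integrable_gallager_integrand:
  assumes "0 < \<alpha>" "\<alpha> < 1" "0 \<le> P" "0 \<le> \<rho>"
  shows "integrable (gain_law u0 \<alpha> N) (\<lambda>u. \<Prod>i\<in>{1..N}. (1 / (1 + P / (1 + \<rho>) * (u i)\<^sup>2)) powr \<rho>)"
proof -
  interpret prob_space "gain_law u0 \<alpha> N" by (rule prob_space_gain_law) fact+
  show ?thesis
    by (rule integrable_const_bound[where B = 1])
      (use gallager_integrand_bounds[OF assms(3,4)] in \<open>auto simp: abs_of_nonneg\<close>)
qed

lemma gain_law_power2_moment:
  assumes "0 < \<alpha>" "\<alpha> < 1" and i: "i \<in> {1..N}"
  shows "has_bochner_integral (gain_law u0 \<alpha> N) (\<lambda>u. (u i)\<^sup>2) (\<alpha> ^ (2 * i) * u0\<^sup>2 + (1 - \<alpha> ^ (2 * i)))"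
proof (rule has_bochner_integral_nn_integral)
  have "(\<lambda>u. u i) \<in> borel_measurable (gain_law u0 \<alpha> N)"
    using i by (simp add: measurable_cong_sets[OF sets_gain_law refl])
  then show "(\<lambda>u. (u i)\<^sup>2) \<in> borel_measurable (gain_law u0 \<alpha> N)" by measurable
  show "0 \<le> \<alpha> ^ (2 * i) * u0\<^sup>2 + (1 - \<alpha> ^ (2 * i))"
    using assms by (intro add_nonneg_nonneg) (auto simp: power_le_one)
  show "(\<integral>\<^sup>+u. ennreal ((u i)\<^sup>2) \<partial>gain_law u0 \<alpha> N) = ennreal (\<alpha> ^ (2 * i) * u0\<^sup>2 + (1 - \<alpha> ^ (2 * i)))"
    using nn_integral_gain_law_power2[OF assms(1,2), of i N u0] i by simp
qed auto

text \<open>Jensen's inequality, in the form of a tangent at the mean of the squared gains.\<close>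

lemma gallager_integral_ge:
  assumes \<alpha>: "0 < \<alpha>" "\<alpha> < 1" and P: "0 < P" and \<rho>: "0 \<le> \<rho>"
  shows "exp (- \<rho> * mean_log_sum P N u0 \<alpha>) \<le> gallager_integral P N \<rho> u0 \<alpha>"
proof -
  interpret prob_space "gain_law u0 \<alpha> N" by (rule prob_space_gain_law) fact+
  define c where "c = P / (1 + \<rho>)"
  have c: "0 \<le> c" "c \<le> P" unfolding c_def using P \<rho> by (auto simp: divide_le_eq mult_le_cancel_left1)
  define m where "m i = \<alpha> ^ (2 * i) * u0\<^sup>2 + (1 - \<alpha> ^ (2 * i))" for i
  have m: "0 \<le> m i" for i
    unfolding m_def using \<alpha> by (intro add_nonneg_nonneg) (auto simp: power_le_one)
  let ?S = "\<Sum>i\<in>{1..N}. ln (1 + c * m i)"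
  let ?D = "\<lambda>u. \<Sum>i\<in>{1..N}. c / (1 + c * m i) * ((u i)\<^sup>2 - m i)"
  have "?S \<le> mean_log_sum P N u0 \<alpha>"
    unfolding mean_log_sum_def m_def[symmetric]
    by (intro sum_mono ln_mono) (use c m in \<open>auto intro!: mult_right_mono add_pos_nonneg\<close>)
  then have "exp (- \<rho> * mean_log_sum P N u0 \<alpha>) \<le> exp (- \<rho> * ?S)"
    using \<rho> by (simp add: mult_left_mono)
  also have "\<dots> = (\<integral>u. exp (- \<rho> * ?S) * (1 - \<rho> * ?D u) \<partial>gain_law u0 \<alpha> N)"
  proof -
    have const: "has_bochner_integral (gain_law u0 \<alpha> N) (\<lambda>_. k) k" for k :: real
      by (simp add: has_bochner_integral_iff prob_space)
    have "has_bochner_integral (gain_law u0 \<alpha> N) (\<lambda>u. c / (1 + c * m i) * ((u i)\<^sup>2 - m i)) (c / (1 + c * m i) * (m i - m i))"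
      if "i \<in> {1..N}" for i
      using gain_law_power2_moment[OF \<alpha> that, of u0]
      unfolding m_def[symmetric]
      by (intro has_bochner_integral_mult_right has_bochner_integral_diff const)
    then have "has_bochner_integral (gain_law u0 \<alpha> N) ?D (\<Sum>i\<in>{1..N}. c / (1 + c * m i) * (m i - m i))"
      by (rule has_bochner_integral_sum)
    \<comment> \<open>The tangent terms are centred at the conditional means, so the affine minorant
      of the integrand integrates to its constant term.\<close>
    then have D: "has_bochner_integral (gain_law u0 \<alpha> N) ?D 0" by simp
    have "has_bochner_integral (gain_law u0 \<alpha> N) (\<lambda>u. exp (- \<rho> * ?S) * (1 - \<rho> * ?D u)) (exp (- \<rho> * ?S) * (1 - \<rho> * 0))"
      by (intro has_bochner_integral_mult_right has_bochner_integral_diff D const)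
    then show ?thesis by (simp add: has_bochner_integral_iff)
  qed
  also have "\<dots> \<le> gallager_integral P N \<rho> u0 \<alpha>"
  proof -
    have "exp (- \<rho> * ?S) * (1 - \<rho> * ?D u) \<le> (\<Prod>i\<in>{1..N}. (1 / (1 + c * (u i)\<^sup>2)) powr \<rho>)" for u
    proof -
      have pos: "0 < 1 + c * (u i)\<^sup>2" "0 < 1 + c * m i" for i
        using c m by (auto intro!: add_pos_nonneg)
      have "ln (1 + c * (u i)\<^sup>2) \<le> ln (1 + c * m i) + c / (1 + c * m i) * ((u i)\<^sup>2 - m i)" for i
      proof -
        have "ln ((1 + c * (u i)\<^sup>2) / (1 + c * m i)) \<le> (1 + c * (u i)\<^sup>2) / (1 + c * m i) - 1"
          using pos by (intro ln_le_minus_one) auto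
        also have "\<dots> = c / (1 + c * m i) * ((u i)\<^sup>2 - m i)"
          using pos[of i] by (simp add: field_simps)
        finally show ?thesis using pos[of i] by (simp add: ln_div)
      qed
      then have "(\<Sum>i\<in>{1..N}. ln (1 + c * (u i)\<^sup>2)) \<le> ?S + ?D u"
        unfolding sum.distrib[symmetric] by (intro sum_mono)
      then have "\<rho> * (\<Sum>i\<in>{1..N}. ln (1 + c * (u i)\<^sup>2)) \<le> \<rho> * (?S + ?D u)"
        using \<rho> by (rule mult_left_mono)
      then have "exp (- \<rho> * ?S) * exp (- \<rho> * ?D u) \<le> exp (- \<rho> * (\<Sum>i\<in>{1..N}. ln (1 + c * (u i)\<^sup>2)))"
        unfolding exp_add[symmetric] by (simp add: ring_distribs)
      also have "\<dots> = (\<Prod>i\<in>{1..N}. (1 / (1 + c * (u i)\<^sup>2)) powr \<rho>)"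
        unfolding sum_distrib_left exp_sum[OF finite_atLeastAtMost]
      proof (intro prod.cong refl)
        fix i
        show "exp (- \<rho> * ln (1 + c * (u i)\<^sup>2)) = (1 / (1 + c * (u i)\<^sup>2)) powr \<rho>"
          using pos[of i] by (simp add: powr_def ln_div)
      qed
      finally have "exp (- \<rho> * ?S) * exp (- \<rho> * ?D u) \<le> (\<Prod>i\<in>{1..N}. (1 / (1 + c * (u i)\<^sup>2)) powr \<rho>)" .
      \<comment> \<open>A second tangent, that of exp at 0. It makes the minorant affine in the
        squared gains, so their means are all that enters.\<close>
      moreover have "exp (- \<rho> * ?S) * (1 - \<rho> * ?D u) \<le> exp (- \<rho> * ?S) * exp (- \<rho> * ?D u)"
        using exp_ge_add_one_self[of "- \<rho> * ?D u"] by (intro mult_left_mono) auto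
      ultimately show ?thesis by linarith
    qed
    moreover have "integrable (gain_law u0 \<alpha> N) (\<lambda>u. exp (- \<rho> * ?S) * (1 - \<rho> * ?D u))"
    proof -
      have "integrable (gain_law u0 \<alpha> N) (\<lambda>u. (u i)\<^sup>2)" if "i \<in> {1..N}" for i
        using gain_law_power2_moment[OF \<alpha> that, of u0] by (simp add: has_bochner_integral_iff)
      then show ?thesis
        by (intro integrable_mult_right Bochner_Integration.integrable_diff
            Bochner_Integration.integrable_sum integrable_const) auto
    qed
    ultimately show ?thesis
      unfolding gallager_integral_def
      using integrable_gallager_integrand[OF \<alpha> less_imp_le[OF P] \<rho>]
      by (intro integral_mono) (auto simp: c_def)
  qed
  finally show ?thesis .
qed

text \<open>Positivity is what allows exp to undo the logarithm in the error exponent.\<close>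

lemma gallager_integral_pos:
  assumes "0 < \<alpha>" "\<alpha> < 1" "0 < P" "0 \<le> \<rho>"
  shows "0 < gallager_integral P N \<rho> u0 \<alpha>"
  using gallager_integral_ge[OF assms, of N u0] by (meson exp_gt_zero less_le_trans)

section \<open>Two-sided bounds for the throughput of one user\<close>

lemma user_throughput_eq:
  assumes \<alpha>: "0 < \<alpha>" "\<alpha> < 1" and P: "0 < P" and N: "1 \<le> N"
  shows "user_throughput P u0 \<alpha> N R =
    R * (1 - (INF \<rho>\<in>{0..1}. gallager_integral P N \<rho> u0 \<alpha> * exp (real N * \<rho> * R)))"
proof -
  have "exp (- (real N * (error_exponent P N \<rho> u0 \<alpha> - \<rho> * R))) = gallager_integral P N \<rho> u0 \<alpha> * exp (real N * \<rho> * R)"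
    if "\<rho> \<in> {0..1}" for \<rho>
  proof -
    have "- (real N * (error_exponent P N \<rho> u0 \<alpha> - \<rho> * R)) = ln (gallager_integral P N \<rho> u0 \<alpha>) + real N * \<rho> * R"
      unfolding error_exponent_def gallager_integral_def[symmetric] using N by (simp add: field_simps)
    then show ?thesis
      using gallager_integral_pos[OF \<alpha> P, of \<rho> N u0] that by (simp add: exp_add)
  qed
  then show ?thesis unfolding user_throughput_def by simp
qed

text \<open>After Jensen the exponent is \<rho> (N R - A), linear in \<rho>, so over [0,1] it is
  smallest at an endpoint: \<rho> = 0 gives error bound 1, \<rho> = 1 gives exp (N R - A). Thus
  optimizing \<rho> brings no gain over these two values.\<close>

lemma user_throughput_le:
  assumes \<alpha>: "0 < \<alpha>" "\<alpha> < 1" and P: "0 < P" and N: "1 \<le> N" and R: "0 \<le> R"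
  shows "user_throughput P u0 \<alpha> N R \<le> R * max 0 (1 - exp (real N * R - mean_log_sum P N u0 \<alpha>))"
proof -
  let ?A = "mean_log_sum P N u0 \<alpha>"
  have "min 1 (exp (real N * R - ?A)) \<le> (INF \<rho>\<in>{0..1}. gallager_integral P N \<rho> u0 \<alpha> * exp (real N * \<rho> * R))"
  proof (rule cINF_greatest)
    fix \<rho> :: real assume \<rho>: "\<rho> \<in> {0..1}"
    have "min 1 (exp (real N * R - ?A)) \<le> exp (\<rho> * (real N * R - ?A))"
    proof (cases "real N * R - ?A \<ge> 0")
      case True
      then have "0 \<le> \<rho> * (real N * R - ?A)" using \<rho> by simp
      then show ?thesis by (simp add: min.coboundedI1)
    next
      case False
      then have "real N * R - ?A \<le> \<rho> * (real N * R - ?A)" using \<rho> by (simp add: mult_le_cancel_right2)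
      then show ?thesis by (simp add: min.coboundedI2)
    qed
    also have "\<dots> = exp (- \<rho> * ?A) * exp (real N * \<rho> * R)"
      unfolding exp_add[symmetric] by (simp add: algebra_simps)
    also have "\<dots> \<le> gallager_integral P N \<rho> u0 \<alpha> * exp (real N * \<rho> * R)"
      using gallager_integral_ge[OF \<alpha> P, of \<rho> N u0] \<rho> by (intro mult_right_mono) auto
    finally show "min 1 (exp (real N * R - ?A)) \<le> gallager_integral P N \<rho> u0 \<alpha> * exp (real N * \<rho> * R)" .
  qed simp
  then have "1 - (INF \<rho>\<in>{0..1}. gallager_integral P N \<rho> u0 \<alpha> * exp (real N * \<rho> * R)) \<le> max 0 (1 - exp (real N * R - ?A))"
    by (auto simp: min_def max_def split: if_splits)
  then show ?thesis
    unfolding user_throughput_eq[OF \<alpha> P N] using R by (rule mult_left_mono)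
qed

lemma user_throughput_ge:
  assumes \<alpha>: "0 < \<alpha>" "\<alpha> < 1" and P: "0 < P" and N: "1 \<le> N" and R: "0 \<le> R"
  shows "R * (1 - gallager_integral P N 1 u0 \<alpha> * exp (real N * R)) \<le> user_throughput P u0 \<alpha> N R"
proof -
  have "(INF \<rho>\<in>{0..1}. gallager_integral P N \<rho> u0 \<alpha> * exp (real N * \<rho> * R))
      \<le> gallager_integral P N 1 u0 \<alpha> * exp (real N * 1 * R)"
  proof (rule cINF_lower)
    show "bdd_below ((\<lambda>\<rho>. gallager_integral P N \<rho> u0 \<alpha> * exp (real N * \<rho> * R)) ` {0..1})"
      using gallager_integral_pos[OF \<alpha> P] by (intro bdd_belowI2[where m = 0]) (auto intro: less_imp_le)
  qed simp
  then show ?thesis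
    unfolding user_throughput_eq[OF \<alpha> P N] using R by (intro mult_left_mono) auto
qed

text \<open>The path space is split. Above the geometric curve each factor is at most the reciprocal
  of its threshold times P / 2, which is P / (1 + \<rho>) at \<rho> = 1; below it the integrand is
  at most 1 and the tail bound gives the probability.\<close>

lemma gallager_integral_one_le:
  assumes \<alpha>: "0 < \<alpha>" "\<alpha> < 1" and P: "0 < P" and \<tau>: "0 < \<tau>" "\<tau> < 1" and u0: "u0 \<noteq> 0"
  defines "\<beta> \<equiv> (1 - \<tau>) * \<alpha>\<^sup>2"
  shows "gallager_integral P N 1 u0 \<alpha>
    \<le> (\<Prod>i\<in>{1..N}. 1 / (P / 2 * (\<beta> ^ i * u0\<^sup>2))) + real N * exp (- (\<tau>\<^sup>2 / 4 * (\<beta> ^ N * u0\<^sup>2)))"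
proof -
  interpret prob_space "gain_law u0 \<alpha> N" by (rule prob_space_gain_law) fact+
  have \<beta>: "0 < \<beta>" unfolding \<beta>_def using \<alpha> \<tau> by simp
  let ?B = "{w. \<exists>i\<in>{1..N}. (w i)\<^sup>2 < \<beta> ^ i * u0\<^sup>2}"
  let ?p = "\<Prod>i\<in>{1..N}. 1 / (P / 2 * (\<beta> ^ i * u0\<^sup>2))"
  let ?f = "\<lambda>u. \<Prod>i\<in>{1..N}. (1 / (1 + P / 2 * (u i)\<^sup>2)) powr 1"
  have fb: "0 \<le> ?f u" "?f u \<le> 1" for u :: "nat \<Rightarrow> real"
    using gallager_integrand_bounds[of P 1 u "{1..N}"] P by auto
  have p: "0 \<le> ?p" using P \<beta> by (intro prod_nonneg) auto
  have "ennreal (gallager_integral P N 1 u0 \<alpha>) = (\<integral>\<^sup>+u. ennreal (?f u) \<partial>gain_law u0 \<alpha> N)"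
    unfolding gallager_integral_def
    using integrable_gallager_integrand[OF \<alpha>, of P 1 u0 N] P fb
    by (subst nn_integral_eq_integral) auto
  also have "\<dots> \<le> (\<integral>\<^sup>+u. ennreal ?p + indicator ?B u \<partial>gain_law u0 \<alpha> N)"
  proof (rule nn_integral_mono)
    fix u :: "nat \<Rightarrow> real"
    show "ennreal (?f u) \<le> ennreal ?p + indicator ?B u"
    proof (cases "u \<in> ?B")
      case True
      have "ennreal (?f u) \<le> ennreal 1" using fb by (intro ennreal_leI)
      also have "\<dots> \<le> ennreal ?p + indicator ?B u" using True by simp
      finally show ?thesis .
    next
      case False
      have "?f u \<le> ?p"
      proof (rule prod_mono)
        fix i assume i: "i \<in> {1..N}"
        have pos: "0 < P / 2 * (\<beta> ^ i * u0\<^sup>2)" using P \<beta> u0 by simp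
        have "P / 2 * (\<beta> ^ i * u0\<^sup>2) \<le> P / 2 * (u i)\<^sup>2" using False i P by (intro mult_left_mono) (auto simp: not_less)
        with pos have "P / 2 * (\<beta> ^ i * u0\<^sup>2) \<le> 1 + P / 2 * (u i)\<^sup>2" "0 < 1 + P / 2 * (u i)\<^sup>2" by linarith+
        with pos have le: "1 / (1 + P / 2 * (u i)\<^sup>2) \<le> 1 / (P / 2 * (\<beta> ^ i * u0\<^sup>2))"
          and nn: "0 \<le> 1 / (1 + P / 2 * (u i)\<^sup>2)"
          by (auto intro!: divide_left_mono simp del: divide_le_eq_1 times_divide_eq_left)
        from le nn show "0 \<le> (1 / (1 + P / 2 * (u i)\<^sup>2)) powr 1 \<and> (1 / (1 + P / 2 * (u i)\<^sup>2)) powr 1 \<le> 1 / (P / 2 * (\<beta> ^ i * u0\<^sup>2))"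
          unfolding powr_one[OF nn] by blast
      qed
      then show ?thesis using False by (simp add: ennreal_leI)
    qed
  qed
  also have "\<dots> = (\<integral>\<^sup>+u. ennreal ?p \<partial>gain_law u0 \<alpha> N) + (\<integral>\<^sup>+u. indicator ?B u \<partial>gain_law u0 \<alpha> N)"
    by (rule nn_integral_add) (use measurable_gain_threshold[of N] in measurable)
  also have "\<dots> \<le> ennreal ?p + ennreal (real N * exp (- (\<tau>\<^sup>2 / 4 * (\<beta> ^ N * u0\<^sup>2))))"
    unfolding \<beta>_def
    by (intro add_mono gain_law_lower_tail[OF \<alpha> \<tau>]) (simp add: emeasure_space_1)
  also have "\<dots> = ennreal (?p + real N * exp (- (\<tau>\<^sup>2 / 4 * (\<beta> ^ N * u0\<^sup>2))))"
    using p by (intro ennreal_plus[symmetric]) auto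
  finally show ?thesis
    by (subst (asm) ennreal_le_iff) (use p in \<open>auto intro: add_nonneg_nonneg\<close>)
qed

section \<open>The selected user\<close>

definition rayleigh_law :: "real measure" where
  "rayleigh_law = density lborel (\<lambda>u. ennreal (rayleigh_density u))"

lemma measurable_rayleigh_density [measurable]: "rayleigh_density \<in> borel_measurable borel"
  unfolding rayleigh_density_def by measurable

lemma sets_rayleigh_law [measurable_cong, simp]: "sets rayleigh_law = sets borel"
  and space_rayleigh_law [simp]: "space rayleigh_law = UNIV"
  by (simp_all add: rayleigh_law_def)

lemma sets_uniform_law [measurable_cong, simp]: "sets uniform_law = sets borel"
  and space_uniform_law [simp]: "space uniform_law = UNIV"
  by (simp_all add: uniform_law_def)

lemma nn_integral_rayleigh_law:
  assumes [measurable]: "f \<in> borel_measurable borel"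
  shows "(\<integral>\<^sup>+u. f u \<partial>rayleigh_law) = (\<integral>\<^sup>+u. ennreal (2 * u * exp (- u\<^sup>2)) * indicator {0..} u * f u \<partial>lborel)"
  unfolding rayleigh_law_def
  by (subst nn_integral_density) (auto intro!: nn_integral_cong simp: rayleigh_density_def indicator_def)

text \<open>The square of a Rayleigh gain is a standard exponential variable; this is its moment
  generating function, needed later for \<open>s\<close> close to 1.\<close>

lemma nn_integral_rayleigh_law_exp:
  assumes "s < 1"
  shows "(\<integral>\<^sup>+u. ennreal (exp (s * u\<^sup>2)) \<partial>rayleigh_law) = ennreal (1 / (1 - s))"
proof -
  have "(\<integral>\<^sup>+u. ennreal (exp (s * u\<^sup>2)) \<partial>rayleigh_law)
     = (\<integral>\<^sup>+u. ennreal (2 * u ^ (2 * 0 + 1) * exp (- (1 - s) * u\<^sup>2)) * indicator {0..} u \<partial>lborel)"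
  proof (subst nn_integral_rayleigh_law, measurable, intro nn_integral_cong)
    fix u :: real
    have "exp (- u\<^sup>2) * exp (s * u\<^sup>2) = exp (- (1 - s) * u\<^sup>2)"
      unfolding exp_add[symmetric] by (simp add: algebra_simps)
    then have "ennreal (2 * u * exp (- u\<^sup>2)) * ennreal (exp (s * u\<^sup>2)) = ennreal (2 * u ^ (2 * 0 + 1) * exp (- (1 - s) * u\<^sup>2))" if "u \<ge> 0"
      using that by (simp add: ennreal_mult[symmetric] mult.assoc)
    then show "ennreal (2 * u * exp (- u\<^sup>2)) * indicator {0..} u * ennreal (exp (s * u\<^sup>2))
      = ennreal (2 * u ^ (2 * 0 + 1) * exp (- (1 - s) * u\<^sup>2)) * indicator {0..} u"
      by (auto simp: indicator_def)
  qed
  also have "\<dots> = ennreal (1 / (1 - s))"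
    using nn_integral_odd_moment[of "1 - s" 0] assms by simp
  finally show ?thesis .
qed

lemma prob_space_rayleigh_law: "prob_space rayleigh_law"
  using nn_integral_rayleigh_law_exp[of 0] by (intro prob_spaceI) simp

lemma rayleigh_law_tail:
  assumes "0 \<le> r"
  shows "emeasure rayleigh_law {r..} = ennreal (exp (- r\<^sup>2))"
proof -
  have "emeasure rayleigh_law {r..} = (\<integral>\<^sup>+u. indicator {r..} u \<partial>rayleigh_law)" by simp
  also have "\<dots> = (\<integral>\<^sup>+u. ennreal (2 * u * exp (- u\<^sup>2)) * indicator {r..} u \<partial>lborel)"
    by (subst nn_integral_rayleigh_law) (use assms in \<open>auto intro!: nn_integral_cong simp: indicator_def\<close>)
  also have "\<dots> = ennreal (0 - (- exp (- r\<^sup>2)))"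
  proof (rule nn_integral_FTC_atLeast)
    show "((\<lambda>x::real. - exp (- x\<^sup>2)) \<longlongrightarrow> 0) at_top" by real_asymp
  qed (use assms in \<open>auto intro!: derivative_eq_intros\<close>)
  finally show ?thesis by simp
qed

lemma rayleigh_law_singleton: "emeasure rayleigh_law {c} = 0"
proof -
  have "emeasure rayleigh_law {c} = (\<integral>\<^sup>+u. ennreal (rayleigh_density u) * indicator {c} u \<partial>lborel)"
    unfolding rayleigh_law_def by (rule emeasure_density) auto
  also have "\<dots> = (\<integral>\<^sup>+u. 0 \<partial>(lborel :: real measure))"
  proof (rule nn_integral_cong_AE, use AE_lborel_singleton[of c] in eventually_elim)
    case (elim u)
    then show ?case by simp
  qed
  finally show ?thesis by simp
qed

lemma prob_space_uniform_law: "prob_space uniform_law"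
  unfolding uniform_law_def by (rule prob_space_uniform_measure) auto

lemma AE_uniform_law: "AE \<alpha> in uniform_law. 0 < \<alpha> \<and> \<alpha> < 1"
  unfolding uniform_law_def by (rule AE_uniform_measureI) auto

section \<open>Integration over the independent users\<close>

definition user_law :: "(real \<times> real) measure" where
  "user_law = rayleigh_law \<Otimes>\<^sub>M uniform_law"

lemma sets_user_law [measurable_cong, simp]: "sets user_law = sets (borel \<Otimes>\<^sub>M borel)"
  unfolding user_law_def by (intro sets_pair_measure_cong sets_rayleigh_law sets_uniform_law)

lemma space_user_law [simp]: "space user_law = UNIV"
  unfolding user_law_def by (simp add: space_pair_measure)

lemma users_law_eq: "users_law K = Pi\<^sub>M {1..K} (\<lambda>_. user_law)"
  unfolding users_law_def user_law_def rayleigh_law_def ..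

lemma prob_space_user_law: "prob_space user_law"
  unfolding user_law_def
  by (intro prob_space_pair prob_space_rayleigh_law prob_space_uniform_law)

interpretation user_prod: product_sigma_finite "\<lambda>_::nat. user_law"
  by (intro product_sigma_finite.intro prob_space_imp_sigma_finite prob_space_user_law)

lemma prob_space_users_law: "prob_space (users_law K)"
  unfolding users_law_eq by (rule prob_space_PiM) (rule prob_space_user_law)

lemma nn_integral_user_law:
  assumes "f \<in> borel_measurable user_law"
  shows "(\<integral>\<^sup>+p. f p \<partial>user_law) = (\<integral>\<^sup>+u. (\<integral>\<^sup>+\<alpha>. f (u, \<alpha>) \<partial>uniform_law) \<partial>rayleigh_law)"
proof -
  interpret prob_space uniform_law by (rule prob_space_uniform_law)
  show ?thesis using assms unfolding user_law_def by (rule nn_integral_fst[symmetric])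
qed

lemma nn_integral_user_law_fst:
  assumes [measurable]: "f \<in> borel_measurable borel"
  shows "(\<integral>\<^sup>+p. f (fst p) \<partial>user_law) = (\<integral>\<^sup>+u. f u \<partial>rayleigh_law)"
proof -
  interpret prob_space uniform_law by (rule prob_space_uniform_law)
  show ?thesis by (subst nn_integral_user_law) (auto simp: emeasure_space_1[simplified])
qed

lemma nn_integral_users_law_split:
  assumes k: "k \<in> {1..K}" and f: "f \<in> borel_measurable (users_law K)"
  shows "(\<integral>\<^sup>+w. f w \<partial>users_law K) = (\<integral>\<^sup>+w. (\<integral>\<^sup>+p. f (w(k := p)) \<partial>user_law) \<partial>Pi\<^sub>M ({1..K} - {k}) (\<lambda>_. user_law))"
proof -
  have ins: "{1..K} = insert k ({1..K} - {k})" using k by auto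
  show ?thesis
    using f unfolding users_law_eq
    by (subst (1) ins, subst user_prod.product_nn_integral_insert) (use ins in auto)
qed

lemma nn_integral_users_law_component:
  assumes k: "k \<in> {1..K}" and [measurable]: "f \<in> borel_measurable user_law"
  shows "(\<integral>\<^sup>+w. f (w k) \<partial>users_law K) = (\<integral>\<^sup>+p. f p \<partial>user_law)"
proof -
  interpret R: prob_space "Pi\<^sub>M ({1..K} - {k}) (\<lambda>_. user_law)"
    by (rule prob_space_PiM) (rule prob_space_user_law)
  have "(\<lambda>w. f (w k)) \<in> borel_measurable (users_law K)"
    unfolding users_law_eq using k by measurable
  then show ?thesis
    by (subst nn_integral_users_law_split[OF k]) (simp_all add: R.emeasure_space_1 del: One_nat_def)
qed

text \<open>With the other users fixed, the gain of user \<open>i\<close> has no atoms. Hence almost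
  surely exactly one user strictly exceeds all others, and the identity of the selected user splits
  the space into disjoint events.\<close>

lemma AE_users_law_no_ties:
  "AE w in users_law K. \<forall>i\<in>{1..K}. \<forall>j\<in>{1..K}. i \<noteq> j \<longrightarrow> fst (w i) \<noteq> fst (w j)"
proof -
  have "AE w in users_law K. fst (w i) \<noteq> fst (w j)" if i: "i \<in> {1..K}" and j: "j \<in> {1..K}" and "i \<noteq> j" for i j
  proof -
    have [measurable]: "(\<lambda>w. fst (w i)) \<in> borel_measurable (users_law K)" "(\<lambda>w. fst (w j)) \<in> borel_measurable (users_law K)"
      unfolding users_law_eq using i j by measurable
    have "Measurable.pred (users_law K) (\<lambda>w. fst (w i) = fst (w j))"
      unfolding pred_def by measurable
    then have ind: "(\<lambda>w. indicator {w. fst (w i) = fst (w j)} w :: ennreal) \<in> borel_measurable (users_law K)"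
      by (simp add: borel_measurable_indicator_iff pred_def Int_def conj_commute)
    have "(\<integral>\<^sup>+w. indicator {w. fst (w i) = fst (w j)} w \<partial>users_law K)
      = (\<integral>\<^sup>+w. (\<integral>\<^sup>+p. indicator {fst (w j)} (fst p) \<partial>user_law) \<partial>Pi\<^sub>M ({1..K} - {i}) (\<lambda>_. user_law))"
      unfolding nn_integral_users_law_split[OF i ind]
      using \<open>i \<noteq> j\<close> by (intro nn_integral_cong) (auto simp: indicator_def)
    also have "\<dots> = 0"
      by (subst nn_integral_user_law_fst) (auto simp: rayleigh_law_singleton)
    finally have "AE w in users_law K. indicator {w. fst (w i) = fst (w j)} w = (0 :: ennreal)"
      by (subst (asm) nn_integral_0_iff_AE[OF ind])
    then show ?thesis by (auto elim!: eventually_mono simp: indicator_def split: if_splits)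
  qed
  then have "\<forall>i\<in>{1..K}. \<forall>j\<in>{1..K}. AE w in users_law K. i \<noteq> j \<longrightarrow> fst (w i) \<noteq> fst (w j)"
    by auto
  then show ?thesis
    by (simp only: AE_ball_countable[OF countable_finite[OF finite_atLeastAtMost]])
qed

section \<open>Selection of the largest initial gain\<close>

lemma best_user:
  assumes "1 \<le> K"
  shows "best_user K w \<in> {1..K}" and "\<And>j. j \<in> {1..K} \<Longrightarrow> fst (w j) \<le> fst (w (best_user K w))"
proof -
  let ?f = "\<lambda>k. fst (w k)"
  have "Max (?f ` {1..K}) \<in> ?f ` {1..K}" using assms by (intro Max_in) auto
  then obtain x where x: "x \<in> {1..K}" and m: "?f x = Max (?f ` {1..K})" by (metis (mono_tags) imageE)
  have "?f y \<le> ?f x" if "y \<in> {1..K}" for y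
    unfolding m using that by (intro Max_ge) auto
  note x = x this
  have "best_user K w \<in> {1..K} \<and> (\<forall>j\<in>{1..K}. ?f j \<le> ?f (best_user K w))"
    unfolding best_user_def
    by (rule arg_maxI[where x = x]) (use x in \<open>auto simp: not_less\<close>)
  then show "best_user K w \<in> {1..K}" and "\<And>j. j \<in> {1..K} \<Longrightarrow> fst (w j) \<le> fst (w (best_user K w))" by auto
qed

text \<open>Without ties exactly one of the strict-maximum events occurs. Each summand is visibly
  measurable, which avoids any discussion of how the arbitrary choice in \<open>ARG_MAX\<close>
  depends on the sample point.\<close>

lemma nn_integral_best_user_sum:
  assumes K: "1 \<le> K" and F: "F \<in> borel_measurable user_law"
  shows "(\<integral>\<^sup>+w. F (w (best_user K w)) \<partial>users_law K) =
    (\<Sum>k\<in>{1..K}. \<integral>\<^sup>+w. indicator {w. \<forall>j\<in>{1..K} - {k}. fst (w j) < fst (w k)} w * F (w k) \<partial>users_law K)"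
proof -
  let ?S = "\<lambda>k. {w. \<forall>j\<in>{1..K} - {k}. fst (w j) < fst (w k)}"
  have "(\<integral>\<^sup>+w. F (w (best_user K w)) \<partial>users_law K) = (\<integral>\<^sup>+w. (\<Sum>k\<in>{1..K}. indicator (?S k) w * F (w k)) \<partial>users_law K)"
  proof (rule nn_integral_cong_AE, use AE_users_law_no_ties in eventually_elim)
    case (elim w)
    let ?b = "best_user K w"
    have "indicator (?S k) w * F (w k) = (if k = ?b then F (w k) else 0)" if "k \<in> {1..K}" for k
    proof (cases "k = ?b")
      case True
      have "fst (w j) < fst (w ?b)" if "j \<in> {1..K} - {?b}" for j
        using best_user(2)[OF K, where w = w] best_user(1)[OF K, where w = w] elim that by (auto simp: order_less_le)
      then show ?thesis using True by (auto simp: indicator_def)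
    next
      case False
      then have "\<not> fst (w ?b) < fst (w k)" using best_user(2)[OF K that, where w = w] by simp
      then have "w \<notin> ?S k" using best_user(1)[OF K, where w = w] False by auto
      then show ?thesis using False by simp
    qed
    then have "(\<Sum>k\<in>{1..K}. indicator (?S k) w * F (w k)) = (\<Sum>k\<in>{1..K}. if k = ?b then F (w k) else 0)"
      by (rule sum.cong[OF refl])
    then show ?case using best_user(1)[OF K, where w = w] by simp
  qed
  also have "\<dots> = (\<Sum>k\<in>{1..K}. \<integral>\<^sup>+w. indicator (?S k) w * F (w k) \<partial>users_law K)"
  proof (rule nn_integral_sum)
    fix k assume k: "k \<in> {1..K}"
    have [measurable]: "(\<lambda>w. F (w k)) \<in> borel_measurable (users_law K)"
      unfolding users_law_eq using k by (intro measurable_compose[OF measurable_component_singleton[OF k, of "\<lambda>_. user_law"] F])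
    have [measurable]: "(\<lambda>w. fst (w j)) \<in> borel_measurable (users_law K)" if "j \<in> {1..K}" for j
      unfolding users_law_eq using that by measurable
    have "Measurable.pred (users_law K) (\<lambda>w. \<forall>j\<in>{1..K} - {k}. fst (w j) < fst (w k))"
      by (intro pred_intros_finite) (use k in auto)
    then show "(\<lambda>w. indicator (?S k) w * F (w k)) \<in> borel_measurable (users_law K)"
      by measurable
  qed
  finally show ?thesis .
qed

text \<open>The selection depends on the initial gains only, so the correlation coefficient of the
  selected user can be averaged first.\<close>

lemma nn_integral_best_user:
  assumes K: "1 \<le> K" and F [measurable]: "F \<in> borel_measurable user_law"
  shows "(\<integral>\<^sup>+w. F (w (best_user K w)) \<partial>users_law K) =
    (\<integral>\<^sup>+w. (\<integral>\<^sup>+\<alpha>. F (fst (w (best_user K w)), \<alpha>) \<partial>uniform_law) \<partial>users_law K)"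
proof -
  interpret U: prob_space uniform_law by (rule prob_space_uniform_law)
  define G where "G u = (\<integral>\<^sup>+\<alpha>. F (u, \<alpha>) \<partial>uniform_law)" for u
  have G [measurable]: "G \<in> borel_measurable borel"
    unfolding G_def by measurable
  have G': "(\<lambda>p. G (fst p)) \<in> borel_measurable user_law" by measurable
  let ?S = "\<lambda>k. {w. \<forall>j\<in>{1..K} - {k}. fst (w j) < fst (w k)}"
  have "(\<integral>\<^sup>+w. indicator (?S k) w * F (w k) \<partial>users_law K) = (\<integral>\<^sup>+w. indicator (?S k) w * G (fst (w k)) \<partial>users_law K)"
    if k: "k \<in> {1..K}" for k
  proof -
    have [measurable]: "(\<lambda>w. fst (w j)) \<in> borel_measurable (users_law K)" if "j \<in> {1..K}" for j
      unfolding users_law_eq using that by measurable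
    have S [measurable]: "Measurable.pred (users_law K) (\<lambda>w. \<forall>j\<in>{1..K} - {k}. fst (w j) < fst (w k))"
      by (intro pred_intros_finite) (use k in auto)
    have m: "(\<lambda>w. indicator (?S k) w * H (w k)) \<in> borel_measurable (users_law K)" if H: "H \<in> borel_measurable user_law" for H :: "real \<times> real \<Rightarrow> ennreal"
    proof -
      have [measurable]: "(\<lambda>w. H (w k)) \<in> borel_measurable (users_law K)"
        unfolding users_law_eq using k by (intro measurable_compose[OF measurable_component_singleton[OF k, of "\<lambda>_. user_law"] H])
      show ?thesis by measurable
    qed
    have split: "(\<integral>\<^sup>+w. indicator (?S k) w * H (w k) \<partial>users_law K)
      = (\<integral>\<^sup>+w. (\<integral>\<^sup>+u. indicator {u. \<forall>j\<in>{1..K} - {k}. fst (w j) < u} u * (\<integral>\<^sup>+\<alpha>. H (u, \<alpha>) \<partial>uniform_law) \<partial>rayleigh_law) \<partial>Pi\<^sub>M ({1..K} - {k}) (\<lambda>_. user_law))"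
      if H [measurable]: "H \<in> borel_measurable user_law" for H :: "real \<times> real \<Rightarrow> ennreal"
    proof -
      have "(\<integral>\<^sup>+w. indicator (?S k) w * H (w k) \<partial>users_law K)
        = (\<integral>\<^sup>+w. (\<integral>\<^sup>+p. indicator {u. \<forall>j\<in>{1..K} - {k}. fst (w j) < u} (fst p) * H p \<partial>user_law) \<partial>Pi\<^sub>M ({1..K} - {k}) (\<lambda>_. user_law))"
        by (subst nn_integral_users_law_split[OF k m[OF H]]) (intro nn_integral_cong, auto simp: indicator_def)
      also have "\<dots> = (\<integral>\<^sup>+w. (\<integral>\<^sup>+u. indicator {u. \<forall>j\<in>{1..K} - {k}. fst (w j) < u} u * (\<integral>\<^sup>+\<alpha>. H (u, \<alpha>) \<partial>uniform_law) \<partial>rayleigh_law) \<partial>Pi\<^sub>M ({1..K} - {k}) (\<lambda>_. user_law))"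
      proof (rule nn_integral_cong)
        fix w :: "nat \<Rightarrow> real \<times> real"
        let ?T = "{u. \<forall>j\<in>{1..K} - {k}. fst (w j) < u}"
        have [measurable]: "?T \<in> sets borel"
        proof -
          have "?T = (\<Inter>j\<in>{1..K} - {k}. {fst (w j)<..})" by auto
          moreover have "open (\<Inter>j\<in>{1..K} - {k}. {fst (w j)<..})" by (intro open_INT) auto
          ultimately show ?thesis by simp
        qed
        show "(\<integral>\<^sup>+p. indicator ?T (fst p) * H p \<partial>user_law) = (\<integral>\<^sup>+u. indicator ?T u * (\<integral>\<^sup>+\<alpha>. H (u, \<alpha>) \<partial>uniform_law) \<partial>rayleigh_law)"
          by (subst nn_integral_user_law) (auto intro!: nn_integral_cong nn_integral_cmult)
      qed
      finally show ?thesis .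
    qed
    \<comment> \<open>\<open>split\<close> replaces an integrand by its \<alpha>-average.
      \<open>G\<close> is already that average and does not depend on \<alpha>, so averaging it
      again returns it and the two right-hand sides agree.\<close>
    show ?thesis
      unfolding split[OF F] split[OF G'] by (simp add: G_def U.emeasure_space_1[simplified])
  qed
  then show ?thesis
    unfolding nn_integral_best_user_sum[OF K F] G_def[symmetric]
    using nn_integral_best_user_sum[OF K G'] by simp
qed

text \<open>All \<open>K\<close> gains lie below sqrt X with probability (1 - exp (- X))^K <= exp (-
  K exp (- X)); otherwise the largest one reaches sqrt X.\<close>

lemma best_user_gain_tail:
  assumes K: "1 \<le> K" and X: "0 \<le> X"
  shows "ennreal (1 - exp (- (real K * exp (- X)))) * c
    \<le> (\<integral>\<^sup>+w. indicator {sqrt X..} (fst (w (best_user K w))) * c \<partial>users_law K)"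
proof -
  interpret prob_space "users_law K" by (rule prob_space_users_law)
  have [measurable]: "(\<lambda>w. fst (w j)) \<in> borel_measurable (users_law K)" if "j \<in> {1..K}" for j
    unfolding users_law_eq using that by measurable
  let ?B = "\<lambda>w. \<Prod>k\<in>{1..K}. indicator {..<sqrt X} (fst (w k)) :: ennreal"
  have "(\<integral>\<^sup>+w. ?B w \<partial>users_law K) = (\<Prod>k\<in>{1..K}. \<integral>\<^sup>+p. indicator {..<sqrt X} (fst p) \<partial>user_law)"
    unfolding users_law_eq by (rule user_prod.product_nn_integral_prod) auto
  also have "\<dots> = ennreal (1 - exp (- X)) ^ K"
  proof -
    interpret R: prob_space rayleigh_law by (rule prob_space_rayleigh_law)
    have "(\<integral>\<^sup>+p. indicator {..<sqrt X} (fst p) \<partial>user_law) = emeasure rayleigh_law {..<sqrt X}"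
      by (subst nn_integral_user_law_fst) auto
    also have "\<dots> = emeasure rayleigh_law (space rayleigh_law - {sqrt X..})"
      by (intro arg_cong[where f = "emeasure rayleigh_law"]) auto
    also have "\<dots> = emeasure rayleigh_law (space rayleigh_law) - emeasure rayleigh_law {sqrt X..}"
      by (rule emeasure_compl) auto
    also have "\<dots> = ennreal (1 - exp (- X))"
      using X by (simp only: R.emeasure_space_1) (simp add: rayleigh_law_tail ennreal_1[symmetric] ennreal_minus del: ennreal_1)
    finally show ?thesis by simp
  qed
  also have "\<dots> \<le> ennreal (exp (- (real K * exp (- X))))"
  proof -
    have "(1 - exp (- X)) ^ K \<le> exp (- exp (- X)) ^ K"
      using X exp_ge_add_one_self[of "- exp (- X)"] by (intro power_mono) auto
    also have "\<dots> = exp (- (real K * exp (- X)))" by (simp add: exp_of_nat_mult[symmetric])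
    finally show ?thesis using X by (simp add: ennreal_power ennreal_leI)
  qed
  finally have B: "(\<integral>\<^sup>+w. ?B w \<partial>users_law K) \<le> ennreal (exp (- (real K * exp (- X))))" .
  let ?E = "{w. \<exists>k\<in>{1..K}. sqrt X \<le> fst (w k)}"
  have Em [measurable]: "Measurable.pred (users_law K) (\<lambda>w. \<exists>k\<in>{1..K}. sqrt X \<le> fst (w k))"
    by (intro pred_intros_finite) auto
  have "1 = (\<integral>\<^sup>+w. 1 \<partial>users_law K)" by (simp add: emeasure_space_1)
  also have "\<dots> \<le> (\<integral>\<^sup>+w. indicator ?E w + ?B w \<partial>users_law K)"
  proof (rule nn_integral_mono)
    fix w :: "nat \<Rightarrow> real \<times> real"
    show "1 \<le> indicator ?E w + ?B w"
    proof (cases "w \<in> ?E")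
      case False
      then have "?B w = (\<Prod>k\<in>{1..K}. 1)" by (intro prod.cong) (auto simp: not_le)
      then show ?thesis by simp
    qed simp
  qed
  also have "\<dots> = (\<integral>\<^sup>+w. indicator ?E w \<partial>users_law K) + (\<integral>\<^sup>+w. ?B w \<partial>users_law K)"
    by (rule nn_integral_add) measurable
  also have "\<dots> \<le> (\<integral>\<^sup>+w. indicator ?E w \<partial>users_law K) + ennreal (exp (- (real K * exp (- X))))"
    using B by (rule add_left_mono)
  finally have "ennreal 1 - ennreal (exp (- (real K * exp (- X)))) \<le> (\<integral>\<^sup>+w. indicator ?E w \<partial>users_law K)"
    by (simp add: ennreal_minus_le_iff add.commute)
  then have "ennreal (1 - exp (- (real K * exp (- X)))) \<le> (\<integral>\<^sup>+w. indicator ?E w \<partial>users_law K)"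
    by (subst (asm) ennreal_minus) auto
  then have "ennreal (1 - exp (- (real K * exp (- X)))) * c \<le> (\<integral>\<^sup>+w. indicator ?E w \<partial>users_law K) * c"
    by (rule mult_right_mono) simp
  \<comment> \<open>The constant is moved under the integral here, where the integrand is the
    indicator of a measurable event; only monotonicity is then applied to the integrand with the
    selected user.\<close>
  also have "\<dots> = (\<integral>\<^sup>+w. indicator ?E w * c \<partial>users_law K)"
    by (rule nn_integral_multc[symmetric]) measurable
  also have "\<dots> \<le> (\<integral>\<^sup>+w. indicator {sqrt X..} (fst (w (best_user K w))) * c \<partial>users_law K)"
  proof (intro nn_integral_mono mult_right_mono)
    fix w :: "nat \<Rightarrow> real \<times> real"
    have "sqrt X \<le> fst (w (best_user K w))" if "w \<in> ?E"
      using that best_user(2)[OF K, where w = w] by (auto intro: order_trans)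
    then show "indicator ?E w \<le> (indicator {sqrt X..} (fst (w (best_user K w))) :: ennreal)"
      by (simp add: indicator_def)
  qed simp
  finally show ?thesis .
qed

text \<open>The excess of the maximum over \<open>L\<close> is controlled by an exponential moment,
  for which the maximum may be replaced by the sum over all users: K users cost the factor exp L,
  which exp (- s L) compensates up to e. So ln of the largest squared gain exceeds ln L by O(1) on
  average. Nonnegativity of \<open>c + ln L\<close> makes the conversion to \<open>ennreal\<close>
  exact.\<close>

lemma nn_integral_best_user_ln_le:
  assumes K: "1 \<le> K" and L: "L = ln (real K)" "2 \<le> L" and c: "0 \<le> c + ln L"
  shows "(\<integral>\<^sup>+w. ennreal (c + ln (max ((fst (w (best_user K w)))\<^sup>2) L)) \<partial>users_law K) \<le> ennreal (c + ln L + 6)"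
proof -
  interpret prob_space "users_law K" by (rule prob_space_users_law)
  \<comment> \<open>This distance to 1 balances two effects: the moment 1 / (1 - s) is
    \<open>L\<close>, cancelled by the \<open>L\<close> in the denominator of \<open>?f\<close>,
    while exp (L - s L) is only e.\<close>
  define s where "s = 1 - 1 / L"
  have s: "1 / 2 \<le> s" "s < 1" unfolding s_def using L by auto
  let ?f = "\<lambda>u. exp (- s * L) / (s * L) * exp (s * u\<^sup>2)"
  have f: "0 \<le> ?f u" for u using s L by simp
  have le: "ln (max (u\<^sup>2) L) \<le> ln L + ?f u" for u
  proof (cases "u\<^sup>2 \<le> L")
    case True
    then show ?thesis using f[of u] by (simp add: max_def)
  next
    case False
    have "0 < u\<^sup>2" using False L by linarith
    then have "ln (u\<^sup>2 / L) \<le> u\<^sup>2 / L - 1" using L by (intro ln_le_minus_one divide_pos_pos) auto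
    also have "\<dots> = s * (u\<^sup>2 - L) / (s * L)" using s L by (simp add: field_simps)
    also have "\<dots> \<le> exp (s * (u\<^sup>2 - L)) / (s * L)"
    proof (rule divide_right_mono)
      show "s * (u\<^sup>2 - L) \<le> exp (s * (u\<^sup>2 - L))"
        using exp_ge_add_one_self[of "s * (u\<^sup>2 - L)"] by linarith
      show "0 \<le> s * L" using s L(2) by simp
    qed
    also have "exp (s * (u\<^sup>2 - L)) = exp (- s * L) * exp (s * u\<^sup>2)"
      unfolding exp_add[symmetric] by (simp add: algebra_simps)
    finally have "ln (u\<^sup>2 / L) \<le> ?f u" by simp
    moreover have "ln (u\<^sup>2 / L) = ln (u\<^sup>2) - ln L" using \<open>0 < u\<^sup>2\<close> L(2) by (simp add: ln_div)
    ultimately show ?thesis using False by (simp add: max_def)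
  qed
  have "(\<integral>\<^sup>+w. ennreal (c + ln (max ((fst (w (best_user K w)))\<^sup>2) L)) \<partial>users_law K)
      \<le> (\<integral>\<^sup>+w. ennreal (c + ln L) + (\<Sum>k\<in>{1..K}. ennreal (?f (fst (w k)))) \<partial>users_law K)"
  proof (rule nn_integral_mono)
    fix w :: "nat \<Rightarrow> real \<times> real"
    let ?b = "best_user K w"
    have "ennreal (c + ln (max ((fst (w ?b))\<^sup>2) L)) \<le> ennreal (c + ln L + ?f (fst (w ?b)))"
      using le[of "fst (w ?b)"] by (intro ennreal_leI) simp
    also have "\<dots> = ennreal (c + ln L) + ennreal (?f (fst (w ?b)))"
      using c f by (rule ennreal_plus)
    also have "\<dots> \<le> ennreal (c + ln L) + (\<Sum>k\<in>{1..K}. ennreal (?f (fst (w k))))"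
      using best_user(1)[OF K, where w = w] by (intro add_left_mono member_le_sum) auto
    finally show "ennreal (c + ln (max ((fst (w ?b))\<^sup>2) L)) \<le> ennreal (c + ln L) + (\<Sum>k\<in>{1..K}. ennreal (?f (fst (w k))))" .
  qed
  also have "\<dots> = ennreal (c + ln L) + (\<Sum>k\<in>{1..K}. \<integral>\<^sup>+w. ennreal (?f (fst (w k))) \<partial>users_law K)"
  proof -
    have m: "(\<lambda>w. ennreal (?f (fst (w k)))) \<in> borel_measurable (users_law K)" if "k \<in> {1..K}" for k
      unfolding users_law_eq using that by measurable
    have "(\<integral>\<^sup>+w. ennreal (c + ln L) + (\<Sum>k\<in>{1..K}. ennreal (?f (fst (w k)))) \<partial>users_law K)
      = (\<integral>\<^sup>+w. ennreal (c + ln L) \<partial>users_law K) + (\<integral>\<^sup>+w. (\<Sum>k\<in>{1..K}. ennreal (?f (fst (w k)))) \<partial>users_law K)"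
      by (rule nn_integral_add) (intro borel_measurable_sum m borel_measurable_const)+
    also have "(\<integral>\<^sup>+w. (\<Sum>k\<in>{1..K}. ennreal (?f (fst (w k)))) \<partial>users_law K)
      = (\<Sum>k\<in>{1..K}. \<integral>\<^sup>+w. ennreal (?f (fst (w k))) \<partial>users_law K)"
      by (rule nn_integral_sum[OF m])
    finally show ?thesis by (simp add: emeasure_space_1)
  qed
  also have "(\<Sum>k\<in>{1..K}. \<integral>\<^sup>+w. ennreal (?f (fst (w k))) \<partial>users_law K) = (\<Sum>k\<in>{1..K}. ennreal (exp (- s * L) / (s * L)) * ennreal L)"
  proof (rule sum.cong[OF refl])
    fix k assume k: "k \<in> {1..K}"
    have "(\<integral>\<^sup>+w. ennreal (?f (fst (w k))) \<partial>users_law K) = (\<integral>\<^sup>+p. ennreal (?f (fst p)) \<partial>user_law)"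
      by (rule nn_integral_users_law_component[OF k]) measurable
    also have "\<dots> = (\<integral>\<^sup>+u. ennreal (?f u) \<partial>rayleigh_law)"
      by (rule nn_integral_user_law_fst) measurable
    also have "\<dots> = (\<integral>\<^sup>+u. ennreal (exp (- s * L) / (s * L)) * ennreal (exp (s * u\<^sup>2)) \<partial>rayleigh_law)"
      using s L by (intro nn_integral_cong ennreal_mult) auto
    also have "\<dots> = ennreal (exp (- s * L) / (s * L)) * ennreal (1 / (1 - s))"
      by (subst nn_integral_cmult) (auto simp: nn_integral_rayleigh_law_exp[OF s(2)])
    also have "1 / (1 - s) = L" unfolding s_def by simp
    finally show "(\<integral>\<^sup>+w. ennreal (?f (fst (w k))) \<partial>users_law K) = ennreal (exp (- s * L) / (s * L)) * ennreal L" .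
  qed
  also have "\<dots> = ennreal (real K * (exp (- s * L) / (s * L) * L))"
  proof -
    have "0 \<le> exp (- s * L) / (s * L)" using s L(2) by simp
    then have "ennreal (real K * (exp (- s * L) / (s * L) * L)) = ennreal (real K) * (ennreal (exp (- s * L) / (s * L)) * ennreal L)"
      using L(2) by (simp only: ennreal_mult mult_nonneg_nonneg of_nat_0_le_iff)
    then show ?thesis by (simp add: ennreal_of_nat_eq_real_of_nat)
  qed
  also have "\<dots> \<le> ennreal 6"
  proof (rule ennreal_leI)
    have "real K = exp L" using K L by simp
    then have "real K * (exp (- s * L) / (s * L) * L) = exp L * exp (- s * L) / s" using L by simp
    also have "exp L * exp (- s * L) = exp 1"
      unfolding exp_add[symmetric] s_def using L by (simp add: field_simps)
    also have "exp 1 / s \<le> 3 / (1 / 2)"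
      using s exp_le by (intro frac_le) auto
    finally show "real K * (exp (- s * L) / (s * L) * L) \<le> 6" by simp
  qed
  finally show ?thesis using c by (subst ennreal_plus) (auto simp: add_left_mono)
qed

section \<open>Upper bound\<close>

lemma uniform_law_eq: "uniform_law = density lborel (\<lambda>x. ennreal (indicator {0<..<1} x))"
  unfolding uniform_law_def uniform_measure_def
  by (intro density_cong) (auto simp: ennreal_indicator divide_ennreal_def)

text \<open>The fundamental theorem on the open interval, with one-sided limits of the
  antiderivative: the integrands of interest are singular at 0. Nonnegativity supplies
  integrability.\<close>

lemma has_bochner_integral_uniform_law:
  fixes f F :: "real \<Rightarrow> real"
  assumes F: "\<And>x. 0 < x \<Longrightarrow> x < 1 \<Longrightarrow> (F has_real_derivative f x) (at x)"
    and f: "\<And>x. 0 < x \<Longrightarrow> x < 1 \<Longrightarrow> isCont f x" "\<And>x. 0 < x \<Longrightarrow> x < 1 \<Longrightarrow> 0 \<le> f x"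
    and [measurable]: "f \<in> borel_measurable borel"
    and lim: "(F \<longlongrightarrow> A) (at_right 0)" "(F \<longlongrightarrow> B) (at_left 1)"
  shows "has_bochner_integral uniform_law f (B - A)"
proof -
  have "0 < (1::ereal)" by simp
  moreover have l1: "((F \<circ> real_of_ereal) \<longlongrightarrow> A) (at_right 0)"
    using lim(1) by (simp add: ereal_tendsto_simps zero_ereal_def)
  moreover have l2: "((F \<circ> real_of_ereal) \<longlongrightarrow> B) (at_left 1)"
    using lim(2) by (simp add: ereal_tendsto_simps one_ereal_def)
  ultimately have "set_integrable lborel (einterval 0 1) f" "(LBINT x=0..1. f x) = B - A"
    using interval_integral_FTC_nonneg[of 0 1 F f A B] F f by auto
  moreover have "einterval 0 1 = {0<..<1::real}"
    by (auto simp: einterval_def)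
  ultimately have "has_bochner_integral lborel (\<lambda>x. indicator {0<..<1} x *\<^sub>R f x) (B - A)"
    by (auto simp: has_bochner_integral_iff set_integrable_def interval_lebesgue_integral_def set_lebesgue_integral_def zero_ereal_def one_ereal_def)
  then show ?thesis
    unfolding uniform_law_eq by (intro has_bochner_integral_density) auto
qed

lemma has_bochner_integral_neg_ln: "has_bochner_integral uniform_law (\<lambda>\<alpha>. ln (inverse \<alpha>)) 1"
proof -
  have "has_bochner_integral uniform_law (\<lambda>\<alpha>. ln (inverse \<alpha>)) (1 - 0)"
  proof (rule has_bochner_integral_uniform_law[where F = "\<lambda>x. x - x * ln x"])
    show "((\<lambda>x. x - x * ln x) \<longlongrightarrow> 0) (at_right (0::real))" by real_asymp
    show "((\<lambda>x. x - x * ln x) \<longlongrightarrow> 1) (at_left (1::real))" by real_asymp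
  qed (auto intro!: derivative_eq_intros continuous_intros simp: ln_inverse)
  then show ?thesis by simp
qed

text \<open>The second moment of a standard exponential variable. It measures the cost of cutting
  off small \<alpha> in both bounds.\<close>

lemma has_bochner_integral_neg_ln_power2: "has_bochner_integral uniform_law (\<lambda>\<alpha>. (ln (inverse \<alpha>))\<^sup>2) 2"
proof -
  have "has_bochner_integral uniform_law (\<lambda>\<alpha>. (ln (inverse \<alpha>))\<^sup>2) (2 - 0)"
  proof (rule has_bochner_integral_uniform_law[where F = "\<lambda>x. x * (ln x)\<^sup>2 - 2 * x * ln x + 2 * x"])
    show "((\<lambda>x. x * (ln x)\<^sup>2 - 2 * x * ln x + 2 * x) \<longlongrightarrow> 0) (at_right (0::real))" by real_asymp
    show "((\<lambda>x. x * (ln x)\<^sup>2 - 2 * x * ln x + 2 * x) \<longlongrightarrow> 2) (at_left (1::real))" by real_asymp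
    fix x :: real assume "0 < x" "x < 1"
    then show "((\<lambda>x. x * (ln x)\<^sup>2 - 2 * x * ln x + 2 * x) has_real_derivative (ln (inverse x))\<^sup>2) (at x)"
      by (auto intro!: derivative_eq_intros simp: ln_inverse)
  qed (auto intro!: continuous_intros)
  then show ?thesis by simp
qed

lemma AE_users_law_correlation:
  "AE w in users_law K. \<forall>k\<in>{1..K}. 0 < snd (w k) \<and> snd (w k) < 1"
proof -
  have "AE p in user_law. 0 < snd p \<and> snd p < 1"
  proof -
    interpret pair_sigma_finite rayleigh_law uniform_law
      by (intro pair_sigma_finite.intro prob_space_imp_sigma_finite prob_space_rayleigh_law prob_space_uniform_law)
    have "AE p in rayleigh_law \<Otimes>\<^sub>M uniform_law. 0 < snd p \<and> snd p < 1"
    proof (rule AE_pair_measure)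
      show "{p \<in> space (rayleigh_law \<Otimes>\<^sub>M uniform_law). 0 < snd p \<and> snd p < 1} \<in> sets (rayleigh_law \<Otimes>\<^sub>M uniform_law)"
        by measurable
    qed (use AE_uniform_law in auto)
    then show ?thesis unfolding user_law_def .
  qed
  then have "AE w in users_law K. 0 < snd (w k) \<and> snd (w k) < 1" if "k \<in> {1..K}" for k
    unfolding users_law_eq using that by (intro AE_PiM_component prob_space_user_law) auto
  then have "\<forall>k\<in>{1..K}. AE w in users_law K. 0 < snd (w k) \<and> snd (w k) < 1" by blast
  then show ?thesis by (simp only: AE_ball_countable[OF countable_finite[OF finite_atLeastAtMost]])
qed

text \<open>By concavity of \<open>min y\<close>, the logarithmic loss at time \<open>i\<close> is at least \<open>i / N\<close> times the
  loss at time \<open>N\<close>.\<close>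

lemma mean_log_sum_le:
  assumes \<alpha>: "0 < \<alpha>" "\<alpha> < 1" and P: "0 < P" and N: "1 \<le> N" and L: "1 \<le> L"
    and y: "y = ln (max (u0\<^sup>2) L)" and l: "0 \<le> l" "l \<le> ln (inverse \<alpha>)"
  shows "mean_log_sum P N u0 \<alpha> \<le> real N * (ln (1 + 2 * P) + y) - (real N + 1) / 2 * min y (2 * real N * l)"
proof -
  let ?l = "ln (inverse \<alpha>)"
  have y0: "0 \<le> y" unfolding y using L by simp
  have ey: "exp y = max (u0\<^sup>2) L" unfolding y using L by (subst exp_ln) auto
  have "ln (1 + P * (\<alpha> ^ (2 * i) * u0\<^sup>2 + (1 - \<alpha> ^ (2 * i)))) \<le> ln (1 + 2 * P) + y - real i / real N * min y (2 * real N * l)"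
    if i: "i \<in> {1..N}" for i
  proof -
    define z where "z = y - 2 * real i * ?l"
    have "exp (- (2 * real i * ?l)) = exp (real (2 * i) * ln \<alpha>)"
      using \<alpha> by (simp add: ln_inverse)
    also have "\<dots> = exp (ln \<alpha>) ^ (2 * i)" by (rule exp_of_nat_mult)
    also have "\<dots> = \<alpha> ^ (2 * i)" using \<alpha> by simp
    finally have "\<alpha> ^ (2 * i) = exp (- (2 * real i * ?l))" ..
    then have "\<alpha> ^ (2 * i) * exp y = exp z" unfolding z_def by (simp add: exp_add[symmetric])
    moreover have "\<alpha> ^ (2 * i) * u0\<^sup>2 \<le> \<alpha> ^ (2 * i) * exp y"
      unfolding ey using \<alpha> by (intro mult_left_mono) auto
    moreover have "0 \<le> \<alpha> ^ (2 * i)" using \<alpha> by simp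
    ultimately have "\<alpha> ^ (2 * i) * u0\<^sup>2 + (1 - \<alpha> ^ (2 * i)) \<le> exp z + 1" by linarith
    then have "1 + P * (\<alpha> ^ (2 * i) * u0\<^sup>2 + (1 - \<alpha> ^ (2 * i))) \<le> 1 + P * (exp z + 1)"
      using P by (intro add_left_mono mult_left_mono) auto
    \<comment> \<open>The cut at 0 is genuine: for negative \<open>z\<close> the stationary part
      dominates and the squared gain has mean at most 2. The other constants go into 1 + 2
      P.\<close>
    also have "\<dots> \<le> (1 + 2 * P) * exp (max 0 z)"
    proof (cases "0 \<le> z")
      case True
      then have "1 \<le> exp z" by simp
      then have "(1 + P) * 1 \<le> (1 + P) * exp z" using P by (intro mult_left_mono) auto
      then show ?thesis using True by (simp add: max_def algebra_simps)
    next
      case False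
      then have "exp z \<le> 1" by simp
      then have "P * exp z \<le> P * 1" using P by (intro mult_left_mono) auto
      then show ?thesis using False by (simp add: max_def algebra_simps)
    qed
    finally have "1 + P * (\<alpha> ^ (2 * i) * u0\<^sup>2 + (1 - \<alpha> ^ (2 * i))) \<le> (1 + 2 * P) * exp (max 0 z)" .
    moreover have "0 < 1 + P * (\<alpha> ^ (2 * i) * u0\<^sup>2 + (1 - \<alpha> ^ (2 * i)))"
      using P \<alpha> by (intro add_pos_nonneg mult_nonneg_nonneg add_nonneg_nonneg) (auto simp: power_le_one)
    ultimately have "ln (1 + P * (\<alpha> ^ (2 * i) * u0\<^sup>2 + (1 - \<alpha> ^ (2 * i)))) \<le> ln ((1 + 2 * P) * exp (max 0 z))"
      by (intro ln_mono) auto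
    also have "\<dots> = ln (1 + 2 * P) + max 0 z" using P by (subst ln_mult) auto
    also have "max 0 z \<le> y - real i / real N * min y (2 * real N * l)"
    proof -
      have t: "0 \<le> real i / real N" "real i / real N \<le> 1" using i by auto
      have m: "0 \<le> min y (2 * real N * l)" using y0 l by simp
      have "real i / real N * min y (2 * real N * l) \<le> y"
        using mult_mono[OF t(2) min.cobounded1[of y "2 * real N * l"]] m t by simp
      moreover have "real i / real N * min y (2 * real N * l) \<le> 2 * real i * ?l"
      proof -
        have "real i / real N * min y (2 * real N * l) \<le> real i / real N * (2 * real N * ?l)"
          using t l by (intro mult_left_mono order_trans[OF min.cobounded2] mult_mono) auto
        then show ?thesis using N by simp
      qed
      ultimately show ?thesis unfolding z_def by simp
    qed
    finally show ?thesis by simp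
  qed
  then have "mean_log_sum P N u0 \<alpha> \<le> (\<Sum>i\<in>{1..N}. ln (1 + 2 * P) + y - real i / real N * min y (2 * real N * l))"
    unfolding mean_log_sum_def by (rule sum_mono)
  also have "\<dots> = real N * (ln (1 + 2 * P) + y) - (\<Sum>i\<in>{1..N}. real i) / real N * min y (2 * real N * l)"
    by (simp add: sum_subtractf sum_divide_distrib sum_distrib_right)
  also have "(\<Sum>i\<in>{1..N}. real i) / real N = (real N + 1) / 2"
  proof -
    have "(\<Sum>i\<in>{1..n}. real i) = real n * (real n + 1) / 2" for n
      by (induction n) (auto simp: field_simps)
    then show ?thesis using N by simp
  qed
  finally show ?thesis .
qed

text \<open>The guaranteed loss per unit of ln (1/\<alpha>). For long codewords it is capped at 2
  sqrt M: this already is the loss to be proved, and the cap keeps the bound valid when the gains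
  decay to O(1) within the codeword.\<close>

definition slope :: "nat \<Rightarrow> real \<Rightarrow> real" where
  "slope N M = (if real N \<le> 2 * sqrt M then real N + 1 else 2 * sqrt M)"

definition rate_margin :: "real \<Rightarrow> nat \<Rightarrow> real \<Rightarrow> real" where
  "rate_margin \<theta> N M = (if real N \<le> 2 * sqrt M then \<theta> * M / real N else 0)"

text \<open>For short codewords the rate has to stay about \<open>M / N\<close> below the mean log-gain, as
  otherwise the error probability exceeds \<open>exp (- \<theta> * M)\<close>; for long ones the decay of the gains
  alone is costly enough.\<close>

lemma user_throughput_upper:
  assumes \<alpha>: "0 < \<alpha>" "\<alpha> < 1" and P: "0 < P" and N: "1 \<le> N" and L: "1 \<le> L" and R: "0 \<le> R"
    and M: "0 \<le> M" and \<theta>: "0 \<le> \<theta>" and B: "0 \<le> B"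
    and c1: "(2 * sqrt M + 1) * B \<le> ln L / 2"
    and c2: "\<theta> * M \<le> ln L / 2 * exp (- \<theta> * M)"
  shows "user_throughput P u0 \<alpha> N R
    \<le> ln (1 + 2 * P) + ln (max (u0\<^sup>2) L) - slope N M * min (ln (inverse \<alpha>)) B - rate_margin \<theta> N M"
    (is "?T \<le> _")
    and "0 \<le> ln (1 + 2 * P) + ln (max (u0\<^sup>2) L) - slope N M * min (ln (inverse \<alpha>)) B - rate_margin \<theta> N M"
proof -
  define y where "y = ln (max (u0\<^sup>2) L)"
  define l where "l = min (ln (inverse \<alpha>)) B"
  define b where "b = ln (1 + 2 * P) + y - slope N M * l"
  have lnL: "0 \<le> ln L" "ln L \<le> y" unfolding y_def using L by auto
  have l: "0 \<le> l" "l \<le> B" "l \<le> ln (inverse \<alpha>)" unfolding l_def using \<alpha> B by (auto simp: ln_inverse)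
  have sM: "0 \<le> sqrt M" using M by simp
  have C1: "0 \<le> ln (1 + 2 * P)" using P by simp
  have slope: "0 \<le> slope N M" "slope N M \<le> 2 * sqrt M + 1" unfolding slope_def using sM by auto
  have sl: "slope N M * l \<le> ln L / 2"
    using order_trans[OF mult_mono[OF slope(2) l(2)] c1] sM l by simp
  have b: "ln L / 2 \<le> b" unfolding b_def using sl lnL C1 by linarith
  \<comment> \<open>By \<open>c1\<close> the cut-off \<open>y\<close> does no harm. For a short
    codeword 2 N l stays below \<open>y\<close>, so the loss is linear in \<open>l\<close>; for a
    long one both arguments of the minimum are at least 4 sqrt M l, which is all that the capped
    slope requires.\<close>
  have min_ge: "slope N M * l * real N \<le> (real N + 1) / 2 * min y (2 * real N * l)"
  proof (cases "real N \<le> 2 * sqrt M")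
    case True
    have "real N * l \<le> 2 * sqrt M * B"
      using mult_mono[OF True l(2)] sM l by simp
    then have "2 * real N * l \<le> 2 * (2 * sqrt M * B)" by (simp only: mult.assoc)
    also have "\<dots> \<le> 2 * ((2 * sqrt M + 1) * B)" using B by (simp add: algebra_simps)
    also have "\<dots> \<le> y" using c1 lnL by simp
    finally have "min y (2 * real N * l) = 2 * real N * l" by simp
    then show ?thesis using True by (simp add: slope_def field_simps)
  next
    case False
    have "2 * sqrt M * B \<le> (2 * sqrt M + 1) * B" using B by (simp add: algebra_simps)
    then have "4 * sqrt M * B \<le> y" using c1 lnL by linarith
    moreover have "4 * sqrt M * l \<le> 4 * sqrt M * B" using l sM by (intro mult_left_mono) auto
    moreover have "4 * sqrt M * l \<le> 2 * real N * l" using False l by (intro mult_right_mono) auto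
    ultimately have "4 * sqrt M * l \<le> min y (2 * real N * l)" by simp
    then have "real N / 2 * (4 * sqrt M * l) \<le> (real N + 1) / 2 * min y (2 * real N * l)"
      using sM l by (intro mult_mono) auto
    then show ?thesis using False by (simp add: slope_def algebra_simps)
  qed
  have "mean_log_sum P N u0 \<alpha> \<le> real N * (ln (1 + 2 * P) + y) - (real N + 1) / 2 * min y (2 * real N * l)"
    by (rule mean_log_sum_le[OF \<alpha> P N L y_def]) (use l in auto)
  also have "\<dots> \<le> real N * b"
    using min_ge unfolding b_def by (simp add: algebra_simps)
  finally have A: "mean_log_sum P N u0 \<alpha> \<le> real N * b" .
  have T: "?T \<le> R * max 0 (1 - exp (real N * (R - b)))"
  proof (rule order_trans[OF user_throughput_le[OF \<alpha> P N R]])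
    have "exp (real N * (R - b)) \<le> exp (real N * R - mean_log_sum P N u0 \<alpha>)"
      using A by (simp add: algebra_simps)
    then show "R * max 0 (1 - exp (real N * R - mean_log_sum P N u0 \<alpha>)) \<le> R * max 0 (1 - exp (real N * (R - b)))"
      using R by (intro mult_left_mono max.mono order.refl diff_left_mono)
  qed
  define d where "d = rate_margin \<theta> N M"
  have \<theta>M: "0 \<le> \<theta> * M" using \<theta> M by simp
  have "ln L / 2 * exp (- \<theta> * M) \<le> ln L / 2 * 1" using lnL \<theta>M by (intro mult_left_mono) auto
  then have \<theta>M': "\<theta> * M \<le> ln L / 2" using c2 by linarith
  have d: "0 \<le> d" "d \<le> \<theta> * M" "real N * d \<le> \<theta> * M"
    unfolding d_def rate_margin_def using \<theta>M N by (auto simp: divide_le_eq mult_le_cancel_left1)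
  \<comment> \<open>Three ranges of rates. Up to b - d the rate is itself the bound; from
    \<open>b\<close> on the throughput bound is 0; in between at least the fraction exp (- \<theta>
    M) of \<open>b\<close> is lost in passing to b (1 - exp (- \<theta> M)), and by
    \<open>c2\<close> and b >= ln L / 2 this is at least \<theta> M >= d.\<close>
  have "R * max 0 (1 - exp (real N * (R - b))) \<le> b - d"
  proof (cases "R \<le> b - d")
    case True
    have "R * max 0 (1 - exp (real N * (R - b))) \<le> R * 1" using R by (intro mult_left_mono) auto
    then show ?thesis using True by linarith
  next
    case False
    show ?thesis
    proof (cases "b \<le> R")
      case True
      then have "exp (real N * (R - b)) \<ge> 1" by simp
      then show ?thesis using b d \<theta>M' by simp
    next
      case b_gt: False
      have "- \<theta> * M \<le> real N * (R - b)"
      proof -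
        have "real N * (b - R) \<le> real N * d" using False by (intro mult_left_mono) auto
        then show ?thesis using d(3) by (simp add: algebra_simps)
      qed
      then have e: "exp (- \<theta> * M) \<le> exp (real N * (R - b))" by (simp only: exp_le_cancel_iff)
      have "R * max 0 (1 - exp (real N * (R - b))) \<le> b * (1 - exp (- \<theta> * M))"
        using R b_gt b lnL e \<theta>M by (intro mult_mono) auto
      also have "\<dots> = b - b * exp (- \<theta> * M)" by (simp add: algebra_simps)
      also have "\<dots> \<le> b - ln L / 2 * exp (- \<theta> * M)" using b by (intro diff_left_mono mult_right_mono) auto
      also have "\<dots> \<le> b - d" using c2 d(2) by linarith
      finally show ?thesis .
    qed
  qed
  then show "?T \<le> ln (1 + 2 * P) + ln (max (u0\<^sup>2) L) - slope N M * min (ln (inverse \<alpha>)) B - rate_margin \<theta> N M"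
    using T unfolding b_def d_def y_def l_def by linarith
  have "0 \<le> b - d" using b d \<theta>M' by linarith
  then show "0 \<le> ln (1 + 2 * P) + ln (max (u0\<^sup>2) L) - slope N M * min (ln (inverse \<alpha>)) B - rate_margin \<theta> N M"
    unfolding b_def d_def y_def l_def by simp
qed

text \<open>The pointwise bound is affine in the truncated ln (1/\<alpha>) and does not contain the
  rate. So the supremum over rates disappears, \<alpha> is averaged by the truncated mean, which is
  at least \<theta>, and the gain by the bound on the expected maximum.\<close>

lemma strategy1_throughput_upper:
  assumes P: "0 < P" and L: "L = ln (real K)" "2 \<le> L"
    and M: "0 \<le> M" and \<theta>: "0 \<le> \<theta>" "\<theta> \<le> 1 - 1 / (2 * B)" and B: "1 \<le> B"
    and c1: "(2 * sqrt M + 1) * B \<le> ln L / 2"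
    and c2: "\<theta> * M \<le> ln L / 2 * exp (- \<theta> * M)"
  shows "strategy1_throughput P K \<le> ennreal (ln (1 + 2 * P) + ln L + 6 - 2 * \<theta> * sqrt M)"
  unfolding strategy1_throughput_def
proof (rule SUP_least)
  fix N :: nat assume N: "N \<in> {1..}"
  interpret U: prob_space uniform_law by (rule prob_space_uniform_law)
  have K: "1 \<le> K" using L by (cases K) auto
  define s where "s = slope N M"
  define d where "d = rate_margin \<theta> N M"
  let ?h = "\<lambda>u \<alpha>. ln (1 + 2 * P) + ln (max (u\<^sup>2) L) - s * min (ln (inverse \<alpha>)) B - d"
  define F where "F p = ennreal (?h (fst p) (snd p))" for p
  have F: "F \<in> borel_measurable user_law" unfolding F_def by measurable
  have bnd: "user_throughput P u \<alpha> N R \<le> ?h u \<alpha>" "0 \<le> ?h u \<alpha>" if "0 < \<alpha>" "\<alpha> < 1" "0 \<le> R" for u \<alpha> R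
    unfolding s_def d_def
    by (rule user_throughput_upper; use that N L(2) P M \<theta>(1) B c1 c2 in simp)+
  have s0: "0 \<le> s" unfolding s_def slope_def using M by simp
  \<comment> \<open>Short codewords: arithmetic-geometric means for N and M / N, in the form (N -
    sqrt M)^2 / N >= 0. Long codewords: the slope alone pays.\<close>
  have sd: "2 * \<theta> * sqrt M \<le> s * \<theta> + d"
  proof (cases "real N \<le> 2 * sqrt M")
    case True
    have "0 \<le> (real N - sqrt M)\<^sup>2 / real N" by simp
    also have "\<dots> = real N - 2 * sqrt M + M / real N"
      using N M by (simp add: power2_eq_square field_simps)
    finally have "2 * sqrt M \<le> real N + 1 + M / real N" by simp
    then have "\<theta> * (2 * sqrt M) \<le> \<theta> * (real N + 1 + M / real N)" using \<theta> by (intro mult_left_mono)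
    then show ?thesis using True by (simp add: s_def d_def slope_def rate_margin_def algebra_simps)
  next
    case False
    then show ?thesis by (simp add: s_def d_def slope_def rate_margin_def)
  qed
  have inner: "(\<integral>\<^sup>+\<alpha>. F (u, \<alpha>) \<partial>uniform_law) \<le> ennreal (ln (1 + 2 * P) - s * \<theta> - d + ln (max (u\<^sup>2) L))" for u
  proof -
    let ?m = "\<lambda>\<alpha>. min (ln (inverse \<alpha>)) B"
    have AE: "AE \<alpha> in uniform_law. 0 \<le> ?m \<alpha> \<and> ?m \<alpha> \<le> B"
      using AE_uniform_law by (rule eventually_mono) (use B in \<open>auto simp: ln_inverse\<close>)
    then have m_int: "integrable uniform_law ?m"
      by (intro U.integrable_const_bound[where B = B]) (auto elim!: eventually_mono)
    have l_int: "integrable uniform_law (\<lambda>\<alpha>. ln (inverse \<alpha>))" "integrable uniform_law (\<lambda>\<alpha>. (ln (inverse \<alpha>))\<^sup>2)"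
      and l_eq: "(\<integral>\<alpha>. ln (inverse \<alpha>) \<partial>uniform_law) = 1" "(\<integral>\<alpha>. (ln (inverse \<alpha>))\<^sup>2 \<partial>uniform_law) = 2"
      using has_bochner_integral_neg_ln has_bochner_integral_neg_ln_power2
      by (auto simp: has_bochner_integral_iff)
    \<comment> \<open>The parabola l - l^2 / (4 B) touches the level \<open>B\<close> at l = 2 B and
      lies below both \<open>l\<close> and \<open>B\<close>; its mean is 1 - 2 / (4 B).\<close>
    have "\<theta> \<le> (\<integral>\<alpha>. ln (inverse \<alpha>) - (ln (inverse \<alpha>))\<^sup>2 / (4 * B) \<partial>uniform_law)"
      using \<theta> by (subst Bochner_Integration.integral_diff) (auto simp: l_int l_eq)
    also have "\<dots> \<le> (\<integral>\<alpha>. ?m \<alpha> \<partial>uniform_law)"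
    proof (rule integral_mono)
      show "integrable uniform_law (\<lambda>\<alpha>. ln (inverse \<alpha>) - (ln (inverse \<alpha>))\<^sup>2 / (4 * B))"
        using l_int by simp
      fix \<alpha> :: real
      have "0 \<le> (ln (inverse \<alpha>) - 2 * B)\<^sup>2 / (4 * B)" using B by simp
      also have "\<dots> = (ln (inverse \<alpha>))\<^sup>2 / (4 * B) - ln (inverse \<alpha>) + B"
        using B by (simp add: power2_eq_square field_simps)
      finally have "ln (inverse \<alpha>) - (ln (inverse \<alpha>))\<^sup>2 / (4 * B) \<le> B" by simp
      moreover have "0 \<le> (ln (inverse \<alpha>))\<^sup>2 / (4 * B)" using B by simp
      ultimately show "ln (inverse \<alpha>) - (ln (inverse \<alpha>))\<^sup>2 / (4 * B) \<le> ?m \<alpha>" by simp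
    qed (rule m_int)
    finally have "s * \<theta> \<le> s * (\<integral>\<alpha>. ?m \<alpha> \<partial>uniform_law)" using s0 by (rule mult_left_mono)
    moreover have "(\<integral>\<alpha>. ?h u \<alpha> \<partial>uniform_law) = ln (1 + 2 * P) + ln (max (u\<^sup>2) L) - s * (\<integral>\<alpha>. ?m \<alpha> \<partial>uniform_law) - d"
      using m_int by (simp add: U.prob_space[simplified])
    moreover have "(\<integral>\<^sup>+\<alpha>. F (u, \<alpha>) \<partial>uniform_law) = ennreal (\<integral>\<alpha>. ?h u \<alpha> \<partial>uniform_law)"
      unfolding F_def fst_conv snd_conv
    proof (rule nn_integral_eq_integral)
      show "integrable uniform_law (?h u)"
        using m_int by (intro Bochner_Integration.integrable_diff integrable_mult_right) auto
      show "AE \<alpha> in uniform_law. 0 \<le> ?h u \<alpha>"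
        using AE_uniform_law by (rule eventually_mono) (use bnd(2)[of _ 0 u] in auto)
    qed
    ultimately show ?thesis by (simp add: ennreal_leI)
  qed
  \<comment> \<open>By \<open>c1\<close> and \<open>c2\<close> each of s \<theta> and
    \<open>d\<close> is at most ln L / 2.\<close>
  have c0: "0 \<le> ln (1 + 2 * P) - s * \<theta> - d + ln L"
  proof -
    have "s \<le> 2 * sqrt M + 1" unfolding s_def slope_def using M by auto
    moreover have "1 - 1 / (2 * B) \<le> 1" using B by simp
    then have "\<theta> \<le> B" using \<theta>(2) B by linarith
    ultimately have "s * \<theta> \<le> (2 * sqrt M + 1) * B" using s0 \<theta> B M by (intro mult_mono) auto
    moreover have "d \<le> \<theta> * M"
      using mult_nonneg_nonneg[OF \<theta>(1) M] N
      by (auto simp: d_def rate_margin_def divide_le_eq mult_le_cancel_left1)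
    moreover have "ln L / 2 * exp (- \<theta> * M) \<le> ln L / 2 * 1" using L M \<theta> by (intro mult_left_mono) auto
    moreover have "0 \<le> ln (1 + 2 * P)" using P by simp
    ultimately show ?thesis using c1 c2 by linarith
  qed
  have "(\<integral>\<^sup>+w. (SUP R\<in>{0..}. ennreal (user_throughput P (fst (w (best_user K w))) (snd (w (best_user K w))) N R)) \<partial>users_law K)
    \<le> (\<integral>\<^sup>+w. F (w (best_user K w)) \<partial>users_law K)"
  proof (rule nn_integral_mono_AE, use AE_users_law_correlation in eventually_elim)
    case (elim w)
    then have "0 < snd (w (best_user K w))" "snd (w (best_user K w)) < 1"
      using best_user(1)[OF K, where w = w] by auto
    then show ?case unfolding F_def by (intro SUP_least ennreal_leI bnd) auto
  qed
  also have "\<dots> = (\<integral>\<^sup>+w. (\<integral>\<^sup>+\<alpha>. F (fst (w (best_user K w)), \<alpha>) \<partial>uniform_law) \<partial>users_law K)"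
    by (rule nn_integral_best_user[OF K F])
  also have "\<dots> \<le> (\<integral>\<^sup>+w. ennreal (ln (1 + 2 * P) - s * \<theta> - d + ln (max ((fst (w (best_user K w)))\<^sup>2) L)) \<partial>users_law K)"
    by (intro nn_integral_mono inner)
  also have "\<dots> \<le> ennreal (ln (1 + 2 * P) - s * \<theta> - d + ln L + 6)"
    by (rule nn_integral_best_user_ln_le[OF K L c0])
  also have "\<dots> \<le> ennreal (ln (1 + 2 * P) + ln L + 6 - 2 * \<theta> * sqrt M)"
    using sd by (intro ennreal_leI) simp
  finally show "(\<integral>\<^sup>+w. (SUP R\<in>{0..}. ennreal (user_throughput P (fst (w (best_user K w))) (snd (w (best_user K w))) N R)) \<partial>users_law K)
    \<le> ennreal (ln (1 + 2 * P) + ln L + 6 - 2 * \<theta> * sqrt M)" .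
qed

section \<open>Lower bound\<close>

text \<open>On good paths the thresholds multiply to the exponent N (H - (N+1)(\<lambda> + t/2)),
  \<open>t\<close> being the extra logarithmic loss per step caused by \<tau>. The hypotheses
  \<open>c1\<close> and \<open>c2\<close> make the failure probability no larger than this, hence
  the factor 2.\<close>

lemma gallager_integral_one_exp_le:
  assumes \<alpha>: "0 < \<alpha>" "\<alpha> < 1" and P: "0 < P" and \<tau>: "0 < \<tau>" "\<tau> < 1" and N: "1 \<le> N"
    and X: "0 < X" "X \<le> u0\<^sup>2" and H: "H = ln (P / 2 * X)"
    and t: "t = - ln (1 - \<tau>)" and l: "ln (inverse \<alpha>) \<le> B"
    and c1: "real N * (2 * B + t) \<le> ln X / 2"
    and c2: "real N * (H + 1) \<le> \<tau>\<^sup>2 / 4 * sqrt X"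
  shows "gallager_integral P N 1 u0 \<alpha> \<le> 2 * exp (- (real N * (H - (real N + 1) * (ln (inverse \<alpha>) + t / 2))))"
proof -
  let ?l = "ln (inverse \<alpha>)"
  define a where "a = H - (real N + 1) * (?l + t / 2)"
  define \<beta> where "\<beta> = (1 - \<tau>) * \<alpha>\<^sup>2"
  have l0: "0 \<le> ?l" using \<alpha> by (simp add: ln_inverse)
  have t0: "0 \<le> t" unfolding t using \<tau> by simp
  have \<beta>: "0 < \<beta>" unfolding \<beta>_def using \<alpha> \<tau> by simp
  have ln\<beta>: "ln \<beta> = - (2 * ?l + t)"
    unfolding \<beta>_def t using \<alpha> \<tau> by (simp add: ln_mult ln_realpow ln_inverse)
  have u0: "u0 \<noteq> 0" using X by auto
  have pow: "\<beta> ^ i = exp (- (real i * (2 * ?l + t)))" for i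
  proof -
    have "\<beta> ^ i = exp (real i * ln \<beta>)" using exp_of_nat_mult[of i "ln \<beta>"] \<beta> by simp
    then show ?thesis by (simp only: ln\<beta> mult_minus_right)
  qed
  have "(\<Prod>i\<in>{1..N}. 1 / (P / 2 * (\<beta> ^ i * u0\<^sup>2))) \<le> (\<Prod>i\<in>{1..N}. exp (- (H - real i * (2 * ?l + t))))"
  proof (rule prod_mono)
    fix i assume "i \<in> {1..N}"
    have "exp (- (H - z)) = 1 / (P / 2 * (exp (- z) * X))" for z
      using P X by (simp add: H exp_minus exp_diff field_simps)
    then have "exp (- (H - real i * (2 * ?l + t))) = 1 / (P / 2 * (\<beta> ^ i * X))"
      unfolding pow .
    moreover have "P / 2 * (\<beta> ^ i * X) \<le> P / 2 * (\<beta> ^ i * u0\<^sup>2)"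
      using P \<beta> X by (intro mult_left_mono) auto
    moreover have "0 < P / 2 * (\<beta> ^ i * X)" using P \<beta> X by simp
    ultimately show "0 \<le> 1 / (P / 2 * (\<beta> ^ i * u0\<^sup>2)) \<and> 1 / (P / 2 * (\<beta> ^ i * u0\<^sup>2)) \<le> exp (- (H - real i * (2 * ?l + t)))"
      using P \<beta> by (auto intro!: divide_left_mono mult_pos_pos simp: u0)
  qed
  also have "\<dots> = exp (\<Sum>i\<in>{1..N}. - (H - real i * (2 * ?l + t)))"
    by (rule exp_sum[symmetric]) simp
  also have "(\<Sum>i\<in>{1..n}. - (H - real i * (2 * ?l + t))) = - (real n * (H - (real n + 1) * (?l + t / 2)))" for n
    by (induction n) (auto simp: field_simps)
  finally have prod: "(\<Prod>i\<in>{1..N}. 1 / (P / 2 * (\<beta> ^ i * u0\<^sup>2))) \<le> exp (- (real N * a))"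
    unfolding a_def .
  have "real N * exp (- (\<tau>\<^sup>2 / 4 * (\<beta> ^ N * u0\<^sup>2))) \<le> exp (- (real N * a))"
  proof -
    \<comment> \<open>The decay over the whole codeword uses up at most half of ln X, so the last
      threshold is still at least sqrt X; a Chernoff bound exponential in sqrt X then beats anything
      polynomial in ln X.\<close>
    have "real N * (2 * ?l + t) \<le> real N * (2 * B + t)" using l by (intro mult_left_mono) auto
    then have "ln X / 2 \<le> - (real N * (2 * ?l + t)) + ln X" using c1 by linarith
    then have "exp (ln X / 2) \<le> exp (- (real N * (2 * ?l + t)) + ln X)" by (simp only: exp_le_cancel_iff)
    then have "exp (ln X / 2) \<le> \<beta> ^ N * X"
      unfolding pow exp_add using X by simp
    moreover have "exp (ln X / 2) = sqrt X"
      unfolding ln_sqrt[OF less_imp_le[OF X(1)], symmetric] using X(1) by simp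
    moreover have "\<beta> ^ N * X \<le> \<beta> ^ N * u0\<^sup>2" using \<beta> X by (intro mult_left_mono) auto
    ultimately have "sqrt X \<le> \<beta> ^ N * u0\<^sup>2" by linarith
    then have "\<tau>\<^sup>2 / 4 * sqrt X \<le> \<tau>\<^sup>2 / 4 * (\<beta> ^ N * u0\<^sup>2)" by (intro mult_left_mono) auto
    moreover have "real N * a \<le> real N * H"
      unfolding a_def using l0 t0 by (intro mult_left_mono) auto
    \<comment> \<open>The additional \<open>real N\<close> absorbs the prefactor N <= exp N of the
      union bound.\<close>
    ultimately have "real N + real N * a \<le> \<tau>\<^sup>2 / 4 * (\<beta> ^ N * u0\<^sup>2)"
      using c2 by (simp add: algebra_simps)
    then have "exp (real N) * exp (- (\<tau>\<^sup>2 / 4 * (\<beta> ^ N * u0\<^sup>2))) \<le> exp (- (real N * a))"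
      unfolding exp_add[symmetric] by simp
    moreover have "real N \<le> exp (real N)" using exp_ge_add_one_self[of "real N"] by linarith
    then have "real N * exp (- (\<tau>\<^sup>2 / 4 * (\<beta> ^ N * u0\<^sup>2))) \<le> exp (real N) * exp (- (\<tau>\<^sup>2 / 4 * (\<beta> ^ N * u0\<^sup>2)))"
      by (intro mult_right_mono) auto
    ultimately show ?thesis by linarith
  qed
  then show ?thesis
    using gallager_integral_one_le[OF \<alpha> P \<tau> u0, of N] prod unfolding a_def \<beta>_def by linarith
qed

text \<open>The rate is set \<open>M / N\<close> below the typical exponent, so the error is at most
  2 exp (- M); as the rate is at most \<open>H\<close>, this costs at most 4 by \<open>c3\<close>,
  which explains the 4 in \<open>D\<close>. The final 2 pays one unit for small \<alpha>
  (\<open>c4\<close>) and one for an exceptionally small maximal gain (\<open>c5\<close>).\<close>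

lemma strategy1_throughput_lower:
  assumes P: "0 < P" and K: "1 \<le> K" and \<tau>: "0 < \<tau>" "\<tau> < 1" and N: "1 \<le> N"
    and X: "0 < X" and H: "H = ln (P / 2 * X)"
    and t: "t = - ln (1 - \<tau>)" and M: "0 \<le> M" and B: "0 < B"
    and c1: "real N * (2 * B + t) \<le> ln X / 2"
    and c2: "real N * (H + 1) \<le> \<tau>\<^sup>2 / 4 * sqrt X"
    and c3: "H * exp (- M) \<le> 2"
    and D: "D = H - (real N + 1) * t / 2 - M / real N - 4" "0 \<le> D"
    and c4: "2 * D / B\<^sup>2 \<le> 1"
    and c5: "D * exp (- (real K * exp (- X))) \<le> 1"
  shows "ennreal (D - (real N + 1) - 2) \<le> strategy1_throughput P K"
proof -
  interpret U: prob_space uniform_law by (rule prob_space_uniform_law)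
  have t0: "0 \<le> t" unfolding t using \<tau> by simp
  let ?l = "\<lambda>\<alpha>::real. ln (inverse \<alpha>)"
  \<comment> \<open>The quadratic term forces the minorant to be nonpositive for ln (1/\<alpha>) >=
    B, where the throughput is merely bounded by 0, while its mean stays explicit through two
    moments.\<close>
  let ?h = "\<lambda>\<alpha>. D - (real N + 1) * ?l \<alpha> - D / B\<^sup>2 * (?l \<alpha>)\<^sup>2"
  let ?T = "\<lambda>p. SUP R\<in>{0..}. ennreal (user_throughput P (fst p) (snd p) N R)"
  define F where "F p = indicator {sqrt X..} (fst p) * ennreal (?h (snd p))" for p
  have F: "F \<in> borel_measurable user_law" unfolding F_def by measurable
  have F_le: "F (u, \<alpha>) \<le> ?T (u, \<alpha>)" if \<alpha>: "0 < \<alpha>" "\<alpha> < 1" for u \<alpha>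
  proof (cases "sqrt X \<le> u \<and> 0 < ?h \<alpha>")
    case False
    then have "F (u, \<alpha>) = 0" by (auto simp: F_def indicator_def ennreal_neg)
    then show ?thesis by simp
  next
    case True
    have l0: "0 \<le> ?l \<alpha>" using \<alpha> by (simp add: ln_inverse)
    have "?l \<alpha> \<le> B"
    proof (rule ccontr)
      assume "\<not> ?l \<alpha> \<le> B"
      then have "B\<^sup>2 \<le> (?l \<alpha>)\<^sup>2" using B by (intro power_mono) auto
      then have "D / B\<^sup>2 * B\<^sup>2 \<le> D / B\<^sup>2 * (?l \<alpha>)\<^sup>2" using D(2) by (intro mult_left_mono) auto
      then have "D \<le> D / B\<^sup>2 * (?l \<alpha>)\<^sup>2" using B by simp
      moreover have "0 \<le> (real N + 1) * ?l \<alpha>" using l0 by simp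
      ultimately show False using True by linarith
    qed
    define a where "a = H - (real N + 1) * (?l \<alpha> + t / 2)"
    define R where "R = a - M / real N"
    have "0 \<le> D / B\<^sup>2 * (?l \<alpha>)\<^sup>2" using D(2) by simp
    moreover have "D - (real N + 1) * ?l \<alpha> = R - 4"
      unfolding R_def a_def D(1) by (simp add: algebra_simps)
    ultimately have R4: "?h \<alpha> \<le> R - 4" by linarith
    then have R: "0 \<le> R" using True by linarith
    have "0 \<le> (real N + 1) * (?l \<alpha> + t / 2)" using l0 t0 by simp
    moreover have "0 \<le> M / real N" using M by simp
    ultimately have RH: "R \<le> H" unfolding R_def a_def by linarith
    have "sqrt X ^ 2 \<le> u\<^sup>2" using True X by (intro power_mono) auto
    then have "X \<le> u\<^sup>2" using X by simp
    then have "gallager_integral P N 1 u \<alpha> * exp (real N * R) \<le> 2 * exp (- (real N * a)) * exp (real N * R)"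
      using gallager_integral_one_exp_le[OF \<alpha> P \<tau> N X _ H t \<open>?l \<alpha> \<le> B\<close> c1 c2, of u]
      unfolding a_def by (intro mult_right_mono) auto
    also have "\<dots> = 2 * exp (- M)"
      unfolding R_def using N by (simp add: exp_add[symmetric] right_diff_distrib)
    finally have g: "gallager_integral P N 1 u \<alpha> * exp (real N * R) \<le> 2 * exp (- M)" .
    have "R * exp (- M) \<le> H * exp (- M)" using RH by (intro mult_right_mono) auto
    then have "R * exp (- M) \<le> 2" using c3 by linarith
    \<comment> \<open>The product of rate and error bound is at most 2 R exp (- M) <= 4.\<close>
    then have "R - 4 \<le> R * (1 - 2 * exp (- M))" by (simp add: algebra_simps)
    also have "\<dots> \<le> R * (1 - gallager_integral P N 1 u \<alpha> * exp (real N * R))"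
      using g R by (intro mult_left_mono) auto
    also have "\<dots> \<le> user_throughput P u \<alpha> N R" by (rule user_throughput_ge[OF \<alpha> P N R])
    finally have "?h \<alpha> \<le> user_throughput P u \<alpha> N R" using R4 by linarith
    then have "ennreal (?h \<alpha>) \<le> ennreal (user_throughput P u \<alpha> N R)" by (rule ennreal_leI)
    also have "\<dots> \<le> ?T (u, \<alpha>)" using R by (intro SUP_upper2[of R]) auto
    finally show ?thesis using True by (simp add: F_def)
  qed
  let ?q = "D - (real N + 1) - 2 * D / B\<^sup>2"
  have h_int: "integrable uniform_law ?h" and h_eq: "(\<integral>\<alpha>. ?h \<alpha> \<partial>uniform_law) = ?q"
  proof -
    have "has_bochner_integral uniform_law (\<lambda>_. D) D"
      by (simp add: has_bochner_integral_iff U.prob_space[simplified])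
    then have "has_bochner_integral uniform_law ?h (D - (real N + 1) * 1 - D / B\<^sup>2 * 2)"
      by (intro has_bochner_integral_diff has_bochner_integral_mult_right has_bochner_integral_neg_ln
          has_bochner_integral_neg_ln_power2)
    then show "integrable uniform_law ?h" "(\<integral>\<alpha>. ?h \<alpha> \<partial>uniform_law) = ?q"
      by (auto simp: has_bochner_integral_iff)
  qed
  have inner: "indicator {sqrt X..} u * ennreal ?q \<le> (\<integral>\<^sup>+\<alpha>. F (u, \<alpha>) \<partial>uniform_law)" for u
  proof -
    \<comment> \<open>Conversion to \<open>ennreal\<close> replaces the minorant by its positive
      part, which can only increase the mean.\<close>
    have "ennreal ?q \<le> ennreal (\<integral>\<alpha>. max 0 (?h \<alpha>) \<partial>uniform_law)"
      unfolding h_eq[symmetric] using h_int by (intro ennreal_leI integral_mono) auto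
    also have "\<dots> = (\<integral>\<^sup>+\<alpha>. ennreal (max 0 (?h \<alpha>)) \<partial>uniform_law)"
      using h_int by (intro nn_integral_eq_integral[symmetric]) auto
    also have "\<dots> = (\<integral>\<^sup>+\<alpha>. ennreal (?h \<alpha>) \<partial>uniform_law)"
      by (intro nn_integral_cong) (auto simp: max_def ennreal_neg)
    finally have "ennreal ?q \<le> (\<integral>\<^sup>+\<alpha>. ennreal (?h \<alpha>) \<partial>uniform_law)" .
    moreover have "(\<integral>\<^sup>+\<alpha>. F (u, \<alpha>) \<partial>uniform_law) = indicator {sqrt X..} u * (\<integral>\<^sup>+\<alpha>. ennreal (?h \<alpha>) \<partial>uniform_law)"
      unfolding F_def fst_conv snd_conv by (rule nn_integral_cmult) measurable
    ultimately show ?thesis by (simp add: mult_left_mono)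
  qed
  let ?p = "1 - exp (- (real K * exp (- X)))"
  have "ennreal (D - (real N + 1) - 2) \<le> ennreal (?q * ?p)"
  proof (cases "0 \<le> ?q")
    case True
    have "0 \<le> 2 * D / B\<^sup>2" using D(2) by simp
    then have "?q \<le> D" by linarith
    then have "?q * exp (- (real K * exp (- X))) \<le> D * exp (- (real K * exp (- X)))" by (intro mult_right_mono) auto
    then have "D - (real N + 1) - 2 \<le> ?q - ?q * exp (- (real K * exp (- X)))" using c4 c5 by linarith
    then show ?thesis by (intro ennreal_leI) (simp only: right_diff_distrib mult_1_right)
  next
    case False
    then have "D - (real N + 1) - 2 \<le> 0" using c4 by linarith
    then show ?thesis by (simp add: ennreal_neg)
  qed
  also have "\<dots> = ennreal ?p * ennreal ?q"
    by (subst mult.commute, rule ennreal_mult') simp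
  also have "\<dots> \<le> (\<integral>\<^sup>+w. indicator {sqrt X..} (fst (w (best_user K w))) * ennreal ?q \<partial>users_law K)"
    by (rule best_user_gain_tail[OF K less_imp_le[OF X]])
  also have "\<dots> \<le> (\<integral>\<^sup>+w. (\<integral>\<^sup>+\<alpha>. F (fst (w (best_user K w)), \<alpha>) \<partial>uniform_law) \<partial>users_law K)"
    by (intro nn_integral_mono inner)
  also have "\<dots> = (\<integral>\<^sup>+w. F (w (best_user K w)) \<partial>users_law K)"
    by (rule nn_integral_best_user[OF K F, symmetric])
  also have "\<dots> \<le> (\<integral>\<^sup>+w. ?T (w (best_user K w)) \<partial>users_law K)"
  proof (rule nn_integral_mono_AE, use AE_users_law_correlation in eventually_elim)
    case (elim w)
    then have "0 < snd (w (best_user K w))" "snd (w (best_user K w)) < 1"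
      using best_user(1)[OF K, where w = w] by auto
    then show ?case using F_le[of "snd (w (best_user K w))" "fst (w (best_user K w))"] by simp
  qed
  also have "\<dots> \<le> strategy1_throughput P K"
    unfolding strategy1_throughput_def using N by (intro SUP_upper2[of N]) auto
  finally show ?thesis .
qed

section \<open>Asymptotics\<close>

lemma filterlim_ln_ln_nat: "filterlim (\<lambda>K. ln (ln (real K))) at_top sequentially"
  by real_asymp

text \<open>With x = ln (ln K) and M = ln x the error level exp (- \<theta> M) is x^(- \<theta>). A
  rate of order x thus loses x^(1 - \<theta>), which for \<theta> < 1 eventually exceeds \<theta> ln
  x; this is where the third logarithm originates.\<close>

lemma eventually_strategy1_throughput_upper:
  assumes P: "0 < P" and \<theta>: "0 < \<theta>" "\<theta> < 1"
  shows "\<forall>\<^sub>F K in sequentially. strategy1_throughput P K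
    \<le> ennreal (ln (1 + 2 * P) + ln (ln (real K)) + 6 - 2 * \<theta> * sqrt (ln (ln (ln (real K)))))"
proof -
  \<comment> \<open>Then 1 - 1 / (2 B) = (1 + \<theta>) / 2, which exceeds \<theta>. The cut-off
    does not grow with K.\<close>
  define B where "B = 1 / (1 - \<theta>)"
  have B: "1 \<le> B" "0 < B" unfolding B_def using \<theta> by auto
  have \<theta>B: "\<theta> \<le> 1 - 1 / (2 * B)" unfolding B_def using \<theta> by (simp add: field_simps)
  have "\<forall>\<^sub>F x in at_top. ln 2 \<le> x \<and> 0 \<le> ln x \<and> (2 * sqrt (ln x) + 1) * B \<le> x / 2 \<and> \<theta> * ln x \<le> x / 2 * exp (- \<theta> * ln x)"
  proof (intro eventually_conj)
    show "\<forall>\<^sub>F x in at_top. ln 2 \<le> (x::real)" by (rule eventually_ge_at_top)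
    show "\<forall>\<^sub>F x in at_top. 0 \<le> ln (x::real)" by real_asymp
    show "\<forall>\<^sub>F x in at_top. (2 * sqrt (ln x) + 1) * B \<le> x / 2" using B by real_asymp
    show "\<forall>\<^sub>F x in at_top. \<theta> * ln x \<le> x / 2 * exp (- \<theta> * ln x)" using \<theta> by real_asymp
  qed
  then have "\<forall>\<^sub>F K in sequentially. ln 2 \<le> ln (ln (real K)) \<and> 0 \<le> ln (ln (ln (real K)))
      \<and> (2 * sqrt (ln (ln (ln (real K)))) + 1) * B \<le> ln (ln (real K)) / 2
      \<and> \<theta> * ln (ln (ln (real K))) \<le> ln (ln (real K)) / 2 * exp (- \<theta> * ln (ln (ln (real K))))"
    by (rule eventually_compose_filterlim[OF _ filterlim_ln_ln_nat])
  moreover have "\<forall>\<^sub>F K in sequentially. 2 \<le> ln (real K)" by real_asymp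
  ultimately show ?thesis
  proof eventually_elim
    case (elim K)
    then show ?case
      using \<theta> \<theta>B B by (intro strategy1_throughput_upper[where B = B] P) auto
  qed
qed

text \<open>The 8 collects 4 + 2 from the finite bound and 2 from N + 1 <= sqrt M + 2; the terms
  with \<open>t\<close> come from (N + 1) t / 2. Both N and M / N contribute sqrt M.\<close>

lemma eventually_strategy1_throughput_lower:
  assumes P: "0 < P" and t: "0 < t"
  shows "\<forall>\<^sub>F K in sequentially.
    ennreal (ln (P / 4) + ln (ln (real K)) - 8 - t - (2 + t / 2) * sqrt (ln (ln (ln (real K))))) \<le> strategy1_throughput P K"
proof -
  define \<tau> where "\<tau> = 1 - exp (- t)"
  have \<tau>: "0 < \<tau>" "\<tau> < 1" and t_eq: "t = - ln (1 - \<tau>)" unfolding \<tau>_def using t by auto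
  define c where "c = \<tau>\<^sup>2 / 4"
  have c: "0 < c" unfolding c_def using \<tau> by simp
  let ?H = "\<lambda>x. ln (P / 4) + x"
  let ?s = "\<lambda>x. sqrt (ln x)"
  \<comment> \<open>The cut-off must satisfy two opposite demands: N B has to stay a small fraction
    of x, and D / B^2, here of order ln x / x, has to vanish.\<close>
  let ?B = "\<lambda>x. x / (16 * ?s x)"
  have ev: "\<forall>\<^sub>F x in at_top. 1 \<le> ln x \<and> 0 \<le> ?H x
      \<and> (?s x + 1) * (2 * ?B x + t) \<le> (x - ln 2) / 2
      \<and> (?s x + 1) * (?H x + 1) \<le> c * exp ((x - ln 2) / 2)
      \<and> ?H x \<le> 2 * x
      \<and> 0 \<le> ?H x - (?s x + 2) * t / 2 - ?s x - 4
      \<and> 2 * ?H x / (?B x)\<^sup>2 \<le> 1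
      \<and> ?H x * exp (- exp (exp x / 2)) \<le> 1"
  proof (intro eventually_conj)
    show "\<forall>\<^sub>F x in at_top. 1 \<le> ln (x::real)" by real_asymp
    show "\<forall>\<^sub>F x in at_top. 0 \<le> ?H x" by real_asymp
    show "\<forall>\<^sub>F x in at_top. (?s x + 1) * (2 * ?B x + t) \<le> (x - ln 2) / 2" using t by real_asymp
    show "\<forall>\<^sub>F x in at_top. (?s x + 1) * (?H x + 1) \<le> c * exp ((x - ln 2) / 2)" using c by real_asymp
    show "\<forall>\<^sub>F x in at_top. ?H x \<le> 2 * x" by real_asymp
    show "\<forall>\<^sub>F x in at_top. 0 \<le> ?H x - (?s x + 2) * t / 2 - ?s x - 4" using t by real_asymp
    show "\<forall>\<^sub>F x in at_top. 2 * ?H x / (?B x)\<^sup>2 \<le> 1" by real_asymp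
    show "\<forall>\<^sub>F x in at_top. ?H x * exp (- exp (exp x / 2)) \<le> 1" by real_asymp
  qed
  have "\<forall>\<^sub>F K in sequentially. 1 < ln (real K)" by real_asymp
  with eventually_compose_filterlim[OF ev filterlim_ln_ln_nat] show ?thesis
  proof eventually_elim
    case (elim K)
    define L where "L = ln (real K)"
    define x where "x = ln L"
    define M where "M = ln x"
    \<comment> \<open>Rounding up gives M / N <= sqrt M, and N exceeds sqrt M by at most
      one.\<close>
    define N where "N = nat \<lceil>sqrt M\<rceil>"
    \<comment> \<open>Half the typical size of the maximal squared gain. This costs only ln 2,
      turning P / 2 into P / 4, and the maximum falls below it with probability at most exp (- sqrt
      K).\<close>
    define X where "X = L / 2"
    have L: "1 < L" using elim unfolding L_def by simp
    have K: "1 \<le> K" using L unfolding L_def by (cases K) auto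
    have ex: "exp x = L" unfolding x_def using L by simp
    have x: "1 \<le> M" "0 \<le> ?H x" "(sqrt M + 1) * (2 * (x / (16 * sqrt M)) + t) \<le> (x - ln 2) / 2"
      "(sqrt M + 1) * (?H x + 1) \<le> c * exp ((x - ln 2) / 2)" "?H x \<le> 2 * x"
      "0 \<le> ?H x - (sqrt M + 2) * t / 2 - sqrt M - 4"
      "2 * ?H x / (x / (16 * sqrt M))\<^sup>2 \<le> 1" "?H x * exp (- exp (exp x / 2)) \<le> 1"
      using elim unfolding M_def x_def L_def by auto
    have xpos: "0 < x" unfolding x_def using L by simp
    have M0: "0 < sqrt M" using x(1) by simp
    have N1: "sqrt M \<le> real N" unfolding N_def by (rule real_nat_ceiling_ge)
    moreover have "real N \<le> sqrt M + 1" unfolding N_def using M0 by linarith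
    moreover have "1 \<le> N" using N1 M0 by (cases N) auto
    ultimately have N: "sqrt M \<le> real N" "real N \<le> sqrt M + 1" "1 \<le> N" by auto
    have X: "0 < X" "ln X = x - ln 2" "sqrt X = exp ((x - ln 2) / 2)"
    proof -
      show "0 < X" unfolding X_def using L by simp
      show lnX: "ln X = x - ln 2" unfolding X_def x_def using L by (simp add: ln_div)
      show "sqrt X = exp ((x - ln 2) / 2)"
        unfolding lnX[symmetric] ln_sqrt[OF less_imp_le[OF \<open>0 < X\<close>], symmetric] using \<open>0 < X\<close> by simp
    qed
    have H: "?H x = ln (P / 2 * X)"
      unfolding X_def x_def using P L by (simp add: ln_mult ln_div)
    define D where "D = ?H x - (real N + 1) * t / 2 - M / real N - 4"
    have MN: "M / real N \<le> sqrt M"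
    proof -
      have "M = sqrt M * sqrt M" using x(1) by simp
      also have "\<dots> \<le> sqrt M * real N" using N M0 by (intro mult_left_mono) auto
      finally show ?thesis using N by (simp add: divide_le_eq)
    qed
    have Nt: "(real N + 1) * t \<le> (sqrt M + 2) * t" using N t by (intro mult_right_mono) auto
    have D0: "0 \<le> D" unfolding D_def using x(6) MN Nt by simp
    have "0 \<le> (real N + 1) * t / 2" "0 \<le> M / real N" using t x(1) by auto
    then have DH: "D \<le> ?H x" unfolding D_def by linarith
    have "ennreal (D - (real N + 1) - 2) \<le> strategy1_throughput P K"
    proof (rule strategy1_throughput_lower[OF P K \<tau> N(3) X(1) H t_eq])
      let ?b = "x / (16 * sqrt M)"
      show "0 \<le> M" using x(1) by simp
      show b: "0 < ?b" using xpos M0 by simp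
      have "real N * (2 * ?b + t) \<le> (sqrt M + 1) * (2 * ?b + t)"
        using N b t by (intro mult_right_mono) auto
      then show "real N * (2 * ?b + t) \<le> ln X / 2" unfolding X(2) using x(3) by (rule order_trans)
      have "real N * (?H x + 1) \<le> (sqrt M + 1) * (?H x + 1)"
        using N x(2) by (intro mult_right_mono) auto
      then show "real N * (?H x + 1) \<le> \<tau>\<^sup>2 / 4 * sqrt X"
        unfolding X(3) c_def[symmetric] using x(4) by (rule order_trans)
      have "exp (- M) = 1 / x" unfolding M_def using xpos by (simp add: exp_minus divide_inverse)
      then show "?H x * exp (- M) \<le> 2" using x(5) xpos by (simp add: divide_le_eq)
      show "D = ?H x - (real N + 1) * t / 2 - M / real N - 4" by (rule D_def)
      show "0 \<le> D" by (rule D0)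
      have "2 * D / ?b\<^sup>2 \<le> 2 * ?H x / ?b\<^sup>2" using DH by (intro divide_right_mono) auto
      then show "2 * D / ?b\<^sup>2 \<le> 1" using x(7) by linarith
      have "real K = exp L" unfolding L_def using K by simp
      then have "real K * exp (- X) = exp (exp x / 2)"
        unfolding X_def ex by (simp add: exp_add[symmetric])
      then have "D * exp (- (real K * exp (- X))) \<le> ?H x * exp (- exp (exp x / 2))"
        using DH by (simp add: mult_right_mono)
      then show "D * exp (- (real K * exp (- X))) \<le> 1" using x(8) by linarith
    qed
    moreover have "ln (P / 4) + x - 8 - t - (2 + t / 2) * sqrt M \<le> D - (real N + 1) - 2"
    proof -
      have "(real N + 1) * t / 2 \<le> t + t / 2 * sqrt M" using Nt by (simp add: algebra_simps)
      moreover have "(2 + t / 2) * sqrt M = 2 * sqrt M + t / 2 * sqrt M" by (rule distrib_right)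
      ultimately show ?thesis unfolding D_def using MN N by linarith
    qed
    ultimately show ?case
      unfolding M_def x_def L_def by (meson ennreal_leI order_trans)
  qed
qed

theorem theorem2:
  fixes P :: real
  assumes "P > 0"
  shows "\<exists>\<epsilon> :: nat \<Rightarrow> real. \<epsilon> \<longlonglongrightarrow> 0 \<and>
    (\<forall>\<^sub>F K in sequentially.
       strategy1_throughput P K < \<infinity> \<and>
       enn2real (strategy1_throughput P K) =
         ln (P * ln (real K) / 2)
         - 2 * (1 + \<epsilon> K) * sqrt ((\<integral>\<alpha>. ln (inverse \<alpha>) \<partial>uniform_law) * ln (ln (ln (real K)))))"
proof -
  have E: "(\<integral>\<alpha>. ln (inverse \<alpha>) \<partial>uniform_law) = 1"
    using has_bochner_integral_neg_ln by (simp add: has_bochner_integral_iff)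
  let ?M = "\<lambda>K. ln (ln (ln (real K)))"
  let ?S = "\<lambda>K. enn2real (strategy1_throughput P K)"
  \<comment> \<open>The value is forced by solving the claimed identity, whose square root contains
    the factor E = 1.\<close>
  define \<epsilon> where "\<epsilon> K = (ln (P * ln (real K) / 2) - ?S K) / (2 * sqrt (?M K)) - 1" for K
  have fin: "\<forall>\<^sub>F K in sequentially. strategy1_throughput P K < \<infinity>"
    using eventually_strategy1_throughput_upper[OF assms, of "1 / 2"]
    by (auto elim!: eventually_mono simp: less_top[symmetric] top_unique)
  have Mpos: "\<forall>\<^sub>F K in sequentially. 0 < ?M K" by real_asymp
  have ln_eq: "\<forall>\<^sub>F K in sequentially. ln (P * ln (real K) / 2) = ln (P / 2) + ln (ln (real K))"
  proof -
    have "\<forall>\<^sub>F K in sequentially. 0 < ln (real K)" by real_asymp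
    then show ?thesis by eventually_elim (use assms in \<open>simp add: ln_mult ln_div\<close>)
  qed
  have "\<epsilon> \<longlonglongrightarrow> 0"
  proof (rule tendstoI)
    fix e0 :: real assume "0 < e0"
    \<comment> \<open>The cap at 1/2 keeps 1 - e / 2 an admissible \<theta>; \<open>e\<close> also
      serves as the slack \<open>t\<close> of the lower bound.\<close>
    define e where "e = min (e0 / 2) (1 / 2)"
    have e: "0 < e" "e < 1" "e < e0" unfolding e_def using \<open>0 < e0\<close> by auto
    have u: "\<forall>\<^sub>F K in sequentially. strategy1_throughput P K
      \<le> ennreal (ln (1 + 2 * P) + ln (ln (real K)) + 6 - 2 * (1 - e / 2) * sqrt (?M K))"
      by (rule eventually_strategy1_throughput_upper[OF assms]) (use e in auto)
    have u0: "\<forall>\<^sub>F K in sequentially. 0 \<le> ln (1 + 2 * P) + ln (ln (real K)) + 6 - 2 * (1 - e / 2) * sqrt (?M K)"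
      by real_asymp
    \<comment> \<open>The upper bound loses only e sqrt M through \<theta>; another e sqrt M is left
      for the bounded constants. \<open>l1\<close> does the same for the lower bound.\<close>
    have u1: "\<forall>\<^sub>F K in sequentially. ln (1 + 2 * P) + 6 - ln (P / 2) \<le> e * sqrt (?M K)"
      using e by real_asymp
    have l: "\<forall>\<^sub>F K in sequentially.
      ennreal (ln (P / 4) + ln (ln (real K)) - 8 - e - (2 + e / 2) * sqrt (?M K)) \<le> strategy1_throughput P K"
      by (rule eventually_strategy1_throughput_lower[OF assms e(1)])
    have l1: "\<forall>\<^sub>F K in sequentially. ln (P / 2) - ln (P / 4) + 8 + e \<le> e * sqrt (?M K)"
      using e by real_asymp
    show "\<forall>\<^sub>F K in sequentially. dist (\<epsilon> K) 0 < e0"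
      using u u0 u1 l l1 fin Mpos ln_eq
    proof eventually_elim
      case (elim K)
      have m: "0 < sqrt (?M K)" using elim by simp
      have "?S K \<le> ln (1 + 2 * P) + ln (ln (real K)) + 6 - 2 * (1 - e / 2) * sqrt (?M K)"
        by (rule enn2real_leI) (use elim in auto)
      then have "2 * (1 - e) * sqrt (?M K) \<le> ln (P * ln (real K) / 2) - ?S K"
        using elim by (simp add: algebra_simps)
      moreover have "ln (P / 4) + ln (ln (real K)) - 8 - e - (2 + e / 2) * sqrt (?M K) \<le> ?S K"
      proof -
        have "strategy1_throughput P K = ennreal (?S K)" using elim by simp
        then have "ennreal (ln (P / 4) + ln (ln (real K)) - 8 - e - (2 + e / 2) * sqrt (?M K)) \<le> ennreal (?S K)"
          using elim by simp
        then show ?thesis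
          using ennreal_le_iff[OF enn2real_nonneg] by (simp only:)
      qed
      then have "ln (P * ln (real K) / 2) - ?S K \<le> 2 * (1 + e) * sqrt (?M K)"
        using elim mult_pos_pos[OF e(1) m] by (simp add: algebra_simps)
      ultimately have "- e \<le> \<epsilon> K" "\<epsilon> K \<le> e"
        unfolding \<epsilon>_def using m by (auto simp: field_simps)
      then show ?case using e by (simp add: dist_real_def)
    qed
  qed
  moreover have "\<forall>\<^sub>F K in sequentially. strategy1_throughput P K < \<infinity> \<and> ?S K =
      ln (P * ln (real K) / 2) - 2 * (1 + \<epsilon> K) * sqrt ((\<integral>\<alpha>. ln (inverse \<alpha>) \<partial>uniform_law) * ?M K)"
    using fin Mpos
  proof eventually_elim
    case (elim K)
    then have "sqrt (?M K) \<noteq> 0" by simp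
    then show ?case using elim unfolding E \<epsilon>_def by (simp add: field_simps)
  qed
  ultimately show ?thesis by blast
qed

end
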